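(* Let $K$ be a field of characteristic $0$ and let $E$ be the infinite dimensional Grassmann algebra over $K$. All polynomial identities in two variables of $M_{11}(E)$ follow from the two polynomials $h=[[x,y]^2,x]$ and $d=[x,y]^3$; that is, the ideal of all $f\in K\langle x,y\rangle$ that are identities of $M_{11}(E)$ is generated, as a T-ideal of $K\langle x,y\rangle$, by $h$ and $d$.
   Context: All algebras are unitary associative over $K$. $K\langle x,y\rangle$ is the free unitary associative algebra on $x,y$; a T-ideal of it is an ideal closed under all its endomorphisms. $[a,b]=ab-ba$. $E=E_0\oplus E_1$ is the Grassmann algebra of a vector space with basis $e_1,e_2,\dots$, with basis $1$ and $e_{i_1}\cdots e_{i_k}$ ($i_1<\dots<i_k$, $k\ge1$) and $e_ie_j=-e_je_i$ (so $e_i^2=0$); $E_0$, $E_1$ are the spans of the basis products of even, respectively odd, length. $M_{11}(E)$ is the subalgebra of $M_2(E)$ consisting of matrices with diagonal entries in $E_0$ and off-diagonal entries in $E_1$. *)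

theory Defs
  imports "HOL-Analysis.Cartesian_Space" "HOL-Library.Poly_Mapping"
begin

section \<open>The free unitary associative algebra\<close>

text \<open>The free monoid of words is written additively, because the convolution product
  of finitely supported functions (\<^type>\<open>poly_mapping\<close>) expects a \<^class>\<open>monoid_add\<close>
  (which is not assumed commutative) as its index type.\<close>

datatype 'v fmonoid = Word (letters: "'v list")

instantiation fmonoid :: (type) monoid_add
begin

definition zero_fmonoid :: "'a fmonoid" where
  "0 = Word []"

definition plus_fmonoid :: "'a fmonoid \<Rightarrow> 'a fmonoid \<Rightarrow> 'a fmonoid" where
  "u + w = Word (letters u @ letters w)"

instance
  by standard (simp_all add: zero_fmonoid_def plus_fmonoid_def)

end

type_synonym ('v, 'k) free_alg = "'v fmonoid \<Rightarrow>\<^sub>0 'k"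

definition scalar :: "'k::comm_ring_1 \<Rightarrow> ('v, 'k) free_alg" where
  "scalar c = Poly_Mapping.single 0 c"

definition var :: "'v \<Rightarrow> ('v, 'k::comm_ring_1) free_alg" where
  "var v = Poly_Mapping.single (Word [v]) 1"

datatype xy = Lx | Ly

abbreviation x_var :: "(xy, 'k::comm_ring_1) free_alg" where "x_var \<equiv> var Lx"
abbreviation y_var :: "(xy, 'k::comm_ring_1) free_alg" where "y_var \<equiv> var Ly"

definition commutator :: "'a::ring \<Rightarrow> 'a \<Rightarrow> 'a" where
  "commutator a b = a * b - b * a"

lemma single_Cons:
  "Poly_Mapping.single (Word (v # w)) c = var v * Poly_Mapping.single (Word w) c"
  by (simp add: var_def mult_single plus_fmonoid_def)

lemma scalar_mult_single:
  "scalar c * Poly_Mapping.single w a = Poly_Mapping.single w (c * a)"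
  by (simp add: scalar_def mult_single)

section \<open>T-ideals\<close>

definition algebra_endo :: "(('v, 'k::comm_ring_1) free_alg \<Rightarrow> ('v, 'k) free_alg) \<Rightarrow> bool" where
  "algebra_endo \<phi> \<longleftrightarrow>
     \<phi> 1 = 1 \<and>
     (\<forall>f g. \<phi> (f + g) = \<phi> f + \<phi> g) \<and>
     (\<forall>f g. \<phi> (f * g) = \<phi> f * \<phi> g) \<and>
     (\<forall>c f. \<phi> (scalar c * f) = scalar c * \<phi> f)"

definition two_sided_ideal :: "'a::ring_1 set \<Rightarrow> bool" where
  "two_sided_ideal I \<longleftrightarrow>
     0 \<in> I \<and>
     (\<forall>f\<in>I. \<forall>g\<in>I. f + g \<in> I) \<and>
     (\<forall>f\<in>I. \<forall>r. r * f \<in> I \<and> f * r \<in> I)"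

definition T_ideal :: "('v, 'k::comm_ring_1) free_alg set \<Rightarrow> bool" where
  "T_ideal I \<longleftrightarrow> two_sided_ideal I \<and> (\<forall>\<phi>. algebra_endo \<phi> \<longrightarrow> \<phi> ` I \<subseteq> I)"

definition T_ideal_generated ::
    "('v, 'k::comm_ring_1) free_alg set \<Rightarrow> ('v, 'k) free_alg set" where
  "T_ideal_generated S = \<Inter> {I. T_ideal I \<and> S \<subseteq> I}"

lemma T_ideal_T_ideal_generated: "T_ideal (T_ideal_generated S)"
  unfolding T_ideal_def T_ideal_generated_def two_sided_ideal_def by blast

lemma T_ideal_generated_superset: "S \<subseteq> T_ideal_generated S"
  unfolding T_ideal_generated_def by blast

section \<open>The Grassmann algebra\<close>

text \<open>The basis product \<open>e\<^bsub>i\<^sub>1\<^esub> \<cdots> e\<^bsub>i\<^sub>k\<^esub>\<close> with \<open>i\<^sub>1 < \<dots> < i\<^sub>k\<close> is represented by the finite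
  set \<open>{i\<^sub>1, \<dots>, i\<^sub>k}\<close> (the unit by the empty set), and an element of the algebra by the family of
  its coefficients. The generators are indexed from 0.\<close>

typedef (overloaded) 'k grassmann =
  "{f :: nat set \<Rightarrow> 'k::zero. finite {A. f A \<noteq> 0} \<and> (\<forall>A. f A \<noteq> 0 \<longrightarrow> finite A)}"
  morphisms gcoeff Abs_grassmann
  by (rule exI[of _ "\<lambda>_. 0"]) simp

setup_lifting type_definition_grassmann

text \<open>Sorting the concatenation of two increasing products with disjoint index sets \<open>A\<close> and
  \<open>B\<close> takes as many transpositions of neighbours as there are inversions.\<close>

definition gsign :: "nat set \<Rightarrow> nat set \<Rightarrow> 'k::comm_ring_1" where
  "gsign A B = (-1) ^ card {(a, b). a \<in> A \<and> b \<in> B \<and> b < a}"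

lemma finite_inversions:
  "finite A \<Longrightarrow> finite B \<Longrightarrow> finite {(a, b). a \<in> A \<and> b \<in> B \<and> b < (a::nat)}"
  by (rule finite_subset[of _ "A \<times> B"]) auto

lemma gsign_empty [simp]: "gsign {} B = 1" "gsign A {} = 1"
  by (simp_all add: gsign_def)

lemma gsign_Un_left:
  assumes "finite A" "finite B" "finite C" "A \<inter> B = {}"
  shows "gsign (A \<union> B) C = (gsign A C * gsign B C :: 'k::comm_ring_1)"
proof -
  let ?I = "\<lambda>A. {(a, b). a \<in> A \<and> b \<in> C \<and> b < (a::nat)}"
  have "?I (A \<union> B) = ?I A \<union> ?I B" "?I A \<inter> ?I B = {}"
    using assms(4) by auto
  then have "card (?I (A \<union> B)) = card (?I A) + card (?I B)"
    using assms by (simp add: card_Un_disjoint finite_inversions)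
  then show ?thesis by (simp add: gsign_def power_add)
qed

lemma gsign_Un_right:
  assumes "finite A" "finite B" "finite C" "B \<inter> C = {}"
  shows "gsign A (B \<union> C) = (gsign A B * gsign A C :: 'k::comm_ring_1)"
proof -
  let ?I = "\<lambda>B. {(a, b). a \<in> A \<and> b \<in> B \<and> b < (a::nat)}"
  have "?I (B \<union> C) = ?I B \<union> ?I C" "?I B \<inter> ?I C = {}"
    using assms(4) by auto
  then have "card (?I (B \<union> C)) = card (?I B) + card (?I C)"
    using assms by (simp add: card_Un_disjoint finite_inversions)
  then show ?thesis by (simp add: gsign_def power_add)
qed

instantiation grassmann :: (comm_ring_1) ring_1
begin

lift_definition zero_grassmann :: "'a grassmann" is "\<lambda>_. 0"
  by simp

lift_definition one_grassmann :: "'a grassmann" is "\<lambda>A. if A = {} then 1 else 0"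
  by auto

lift_definition plus_grassmann :: "'a grassmann \<Rightarrow> 'a grassmann \<Rightarrow> 'a grassmann"
  is "\<lambda>f g A. f A + g A"
proof -
  fix f g :: "nat set \<Rightarrow> 'a"
  assume f: "finite {A. f A \<noteq> 0} \<and> (\<forall>A. f A \<noteq> 0 \<longrightarrow> finite A)"
    and g: "finite {A. g A \<noteq> 0} \<and> (\<forall>A. g A \<noteq> 0 \<longrightarrow> finite A)"
  have "finite {A. f A + g A \<noteq> 0}"
    by (rule finite_subset[of _ "{A. f A \<noteq> 0} \<union> {A. g A \<noteq> 0}"]) (use f g in auto)
  moreover have "\<forall>A. f A + g A \<noteq> 0 \<longrightarrow> finite A" using f g by force
  ultimately show "finite {A. f A + g A \<noteq> 0} \<and> (\<forall>A. f A + g A \<noteq> 0 \<longrightarrow> finite A)" ..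
qed

lift_definition uminus_grassmann :: "'a grassmann \<Rightarrow> 'a grassmann" is "\<lambda>f A. - f A"
  by simp

definition minus_grassmann :: "'a grassmann \<Rightarrow> 'a grassmann \<Rightarrow> 'a grassmann" where
  "f - g = f + - (g :: 'a grassmann)"

lift_definition times_grassmann :: "'a grassmann \<Rightarrow> 'a grassmann \<Rightarrow> 'a grassmann"
  is "\<lambda>f g C. \<Sum>A\<in>Pow C. gsign A (C - A) * (f A * g (C - A))"
proof -
  fix f g :: "nat set \<Rightarrow> 'a"
  let ?h = "\<lambda>C. \<Sum>A\<in>Pow C. gsign A (C - A) * (f A * g (C - A))"
  assume f: "finite {A. f A \<noteq> 0} \<and> (\<forall>A. f A \<noteq> 0 \<longrightarrow> finite A)"
    and g: "finite {A. g A \<noteq> 0} \<and> (\<forall>A. g A \<noteq> 0 \<longrightarrow> finite A)"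
  have *: "\<exists>A B. f A \<noteq> 0 \<and> g B \<noteq> 0 \<and> C = A \<union> B" if "?h C \<noteq> 0" for C
  proof -
    from that obtain A where "A \<in> Pow C" "gsign A (C - A) * (f A * g (C - A)) \<noteq> 0"
      by (meson sum.neutral)
    then have "f A \<noteq> 0" "g (C - A) \<noteq> 0" "C = A \<union> (C - A)" by auto
    then show ?thesis by blast
  qed
  have "finite {C. ?h C \<noteq> 0}"
  proof (rule finite_subset)
    show "{C. ?h C \<noteq> 0} \<subseteq> (\<lambda>(A, B). A \<union> B) ` ({A. f A \<noteq> 0} \<times> {B. g B \<noteq> 0})"
      using * by fast
    show "finite ((\<lambda>(A, B). A \<union> B) ` ({A. f A \<noteq> 0} \<times> {B. g B \<noteq> 0}))"
      using f g by simp
  qed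
  moreover have "\<forall>C. ?h C \<noteq> 0 \<longrightarrow> finite C"
  proof (intro allI impI)
    fix C
    assume "?h C \<noteq> 0"
    then obtain A B where "f A \<noteq> 0" "g B \<noteq> 0" "C = A \<union> B" using * by blast
    then show "finite C" using f g by simp
  qed
  ultimately show "finite {C. ?h C \<noteq> 0} \<and> (\<forall>C. ?h C \<noteq> 0 \<longrightarrow> finite C)" ..
qed

instance
proof
  fix a b c :: "'a grassmann"
  show "a + b + c = a + (b + c)" by transfer (simp add: add.assoc)
  show "a + b = b + a" by transfer (simp add: add.commute)
  show "0 + a = a" by transfer simp
  show "- a + a = 0" by transfer simp
  show "a - b = a + - b" by (rule minus_grassmann_def)
  show "(a + b) * c = a * c + b * c"
    by transfer (simp add: algebra_simps sum.distrib)
  show "a * (b + c) = a * b + a * c"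
    by transfer (simp add: algebra_simps sum.distrib)
  show "(0 :: 'a grassmann) \<noteq> 1"
    by transfer (metis zero_neq_one)
  show "1 * a = a"
  proof transfer
    fix f :: "nat set \<Rightarrow> 'a"
    assume f: "finite {A. f A \<noteq> 0} \<and> (\<forall>A. f A \<noteq> 0 \<longrightarrow> finite A)"
    show "(\<lambda>C. \<Sum>A\<in>Pow C. gsign A (C - A) * ((if A = {} then 1 else 0) * f (C - A))) = f"
    proof
      fix C
      show "(\<Sum>A\<in>Pow C. gsign A (C - A) * ((if A = {} then 1 else 0) * f (C - A))) = f C"
      proof (cases "finite C")
        case True
        have "(\<Sum>A\<in>Pow C. gsign A (C - A) * ((if A = {} then 1 else 0) * f (C - A)))
            = (\<Sum>A\<in>Pow C. if A = {} then f C else 0)"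
          by (rule sum.cong) auto
        then show ?thesis using True by simp
      next
        case False
        then have "f C = 0" using f by blast
        then show ?thesis using False by simp
      qed
    qed
  qed
  show "a * 1 = a"
  proof transfer
    fix f :: "nat set \<Rightarrow> 'a"
    assume f: "finite {A. f A \<noteq> 0} \<and> (\<forall>A. f A \<noteq> 0 \<longrightarrow> finite A)"
    show "(\<lambda>C. \<Sum>A\<in>Pow C. gsign A (C - A) * (f A * (if C - A = {} then 1 else 0))) = f"
    proof
      fix C
      show "(\<Sum>A\<in>Pow C. gsign A (C - A) * (f A * (if C - A = {} then 1 else 0))) = f C"
      proof (cases "finite C")
        case True
        have "(\<Sum>A\<in>Pow C. gsign A (C - A) * (f A * (if C - A = {} then 1 else 0)))
            = (\<Sum>A\<in>Pow C. if A = C then f C else 0)"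
          by (rule sum.cong) auto
        then show ?thesis using True by simp
      next
        case False
        then have "f C = 0" using f by blast
        then show ?thesis using False by simp
      qed
    qed
  qed
  show "a * b * c = a * (b * c)"
  proof transfer
    fix f g h :: "nat set \<Rightarrow> 'a"
    show "(\<lambda>C. \<Sum>A\<in>Pow C. gsign A (C - A) *
              ((\<Sum>B\<in>Pow A. gsign B (A - B) * (f B * g (A - B))) * h (C - A)))
        = (\<lambda>C. \<Sum>A\<in>Pow C. gsign A (C - A) *
              (f A * (\<Sum>B\<in>Pow (C - A). gsign B (C - A - B) * (g B * h (C - A - B)))))"
      (is "?L = ?R")
    proof
      fix C
      show "?L C = ?R C"
      proof (cases "finite C")
        case False
        then show ?thesis by simp
      next
        case fin: True
        have finD: "finite A" if "A \<subseteq> C" for A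
          using that fin by (rule finite_subset)
        have "?L C = (\<Sum>(A, B)\<in>Sigma (Pow C) Pow.
                gsign A (C - A) * (gsign B (A - B) * (f B * g (A - B)) * h (C - A)))"
          using fin finD by (simp add: sum_distrib_left sum_distrib_right sum.Sigma)
        also have "\<dots> = (\<Sum>(A, B)\<in>(SIGMA A:Pow C. Pow (C - A)).
                gsign A (C - A) * (f A * (gsign B (C - A - B) * (g B * h (C - A - B)))))"
        proof (rule sum.reindex_bij_witness[where
              i = "\<lambda>(A, B). (A \<union> B, A)" and j = "\<lambda>(A, B). (B, A - B)"])
          fix p assume "p \<in> Sigma (Pow C) Pow"
          then obtain A B where p: "p = (A, B)" "A \<subseteq> C" "B \<subseteq> A" by auto
          define U V where "U = A - B" and "V = C - A"
          have A: "A = B \<union> U" and C: "C - B = U \<union> V" and V: "C - B - U = V"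
            and disj: "B \<inter> U = {}" "U \<inter> V = {}"
            using p unfolding U_def V_def by auto
          have "finite B" "finite U" "finite V"
            using p by (auto simp: U_def V_def intro!: finD)
          then have *: "gsign A V = (gsign B V * gsign U V :: 'a)"
            "gsign B (C - B) = (gsign B U * gsign B V :: 'a)"
            unfolding A C using disj by (simp_all add: gsign_Un_left gsign_Un_right)
          show "(case (case p of (A, B) \<Rightarrow> (B, A - B)) of (A, B) \<Rightarrow>
                  gsign A (C - A) * (f A * (gsign B (C - A - B) * (g B * h (C - A - B)))))
              = (case p of (A, B) \<Rightarrow>
                  gsign A (C - A) * (gsign B (A - B) * (f B * g (A - B)) * h (C - A)))"
            unfolding p(1) prod.case
            unfolding U_def[symmetric] V_def[symmetric] V *
            by (simp add: ac_simps)
        qed auto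
        also have "\<dots> = ?R C"
          using fin finD by (simp add: sum_distrib_left sum.Sigma)
        finally show ?thesis .
      qed
    qed
  qed
qed

end

lift_definition gscale :: "'k::comm_ring_1 \<Rightarrow> 'k grassmann \<Rightarrow> 'k grassmann"
  is "\<lambda>c f A. c * f A"
proof -
  fix c :: 'k and f :: "nat set \<Rightarrow> 'k"
  assume f: "finite {A. f A \<noteq> 0} \<and> (\<forall>A. f A \<noteq> 0 \<longrightarrow> finite A)"
  have "finite {A. c * f A \<noteq> 0}"
    by (rule finite_subset[of _ "{A. f A \<noteq> 0}"]) (use f in auto)
  moreover have "\<forall>A. c * f A \<noteq> 0 \<longrightarrow> finite A" using f by force
  ultimately show "finite {A. c * f A \<noteq> 0} \<and> (\<forall>A. c * f A \<noteq> 0 \<longrightarrow> finite A)" ..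
qed

text \<open>For an infinite index set the following is 0 (a junk value).\<close>

lift_definition gbasis :: "nat set \<Rightarrow> 'k::comm_ring_1 grassmann"
  is "\<lambda>A B. if finite A \<and> B = A then 1 else 0"
  by auto

abbreviation ggen :: "nat \<Rightarrow> 'k::comm_ring_1 grassmann" where
  "ggen i \<equiv> gbasis {i}"

definition grass_even :: "'k::comm_ring_1 grassmann set" where
  "grass_even = module.span gscale (gbasis ` {A. finite A \<and> even (card A)})"

definition grass_odd :: "'k::comm_ring_1 grassmann set" where
  "grass_odd = module.span gscale (gbasis ` {A. finite A \<and> odd (card A)})"

lemma module_gscale: "module (gscale :: 'k::comm_ring_1 \<Rightarrow> _)"
  by unfold_locales (transfer; simp add: algebra_simps)+

lemma gscale_mult:
  "gscale c a * b = gscale c (a * b)" "a * gscale c b = gscale c (a * b)"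
  by (transfer; simp add: sum_distrib_left ac_simps)+

lemma gcoeff_finite: "finite {A. gcoeff a A \<noteq> 0}" "gcoeff a A \<noteq> 0 \<Longrightarrow> finite A"
  using gcoeff[of a] by auto

lemma grassmann_eqI: "(\<And>A. gcoeff a A = gcoeff b A) \<Longrightarrow> a = b"
  by (simp add: gcoeff_inject[symmetric] fun_eq_iff)

lemma gcoeff_sum: "gcoeff (\<Sum>i\<in>I. f i) A = (\<Sum>i\<in>I. gcoeff (f i) A)"
  by (induction I rule: infinite_finite_induct)
    (simp_all add: zero_grassmann.rep_eq plus_grassmann.rep_eq)

lemma grassmann_expansion:
  "a = (\<Sum>A | gcoeff a A \<noteq> 0. gscale (gcoeff a A) (gbasis A))"
proof (rule grassmann_eqI)
  fix B
  have "(\<Sum>A | gcoeff a A \<noteq> 0. gcoeff a A * (if finite A \<and> B = A then 1 else 0))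
      = (\<Sum>A | gcoeff a A \<noteq> 0. if A = B then gcoeff a B else 0)"
    by (rule sum.cong) (auto simp: gcoeff_finite(2))
  then show "gcoeff a B = gcoeff (\<Sum>A | gcoeff a A \<noteq> 0. gscale (gcoeff a A) (gbasis A)) B"
    by (simp add: gcoeff_sum gscale.rep_eq gbasis.rep_eq gcoeff_finite)
qed

lemma span_gbasis:
  assumes "\<And>A. P A \<Longrightarrow> finite A"
  shows "module.span gscale (gbasis ` Collect P)
      = {a :: 'k::comm_ring_1 grassmann. \<forall>A. gcoeff a A \<noteq> 0 \<longrightarrow> P A}"
    (is "?S = ?T")
proof
  interpret module "gscale :: 'k \<Rightarrow> _" by (rule module_gscale)
  have "subspace ?T"
    by (rule subspaceI)
      (auto simp: zero_grassmann.rep_eq plus_grassmann.rep_eq gscale.rep_eq,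
        force, metis mult_zero_right)
  then show "?S \<subseteq> ?T"
    by (rule span_minimal[rotated]) (auto simp: gbasis.rep_eq split: if_splits)
  show "?T \<subseteq> ?S"
  proof
    fix a assume "a \<in> ?T"
    then have "(\<Sum>A | gcoeff a A \<noteq> 0. gscale (gcoeff a A) (gbasis A)) \<in> ?S"
      by (intro span_sum span_scale span_base) auto
    then show "a \<in> ?S" using grassmann_expansion[of a] by simp
  qed
qed

lemma grass_even_iff: "a \<in> grass_even \<longleftrightarrow> (\<forall>A. gcoeff a A \<noteq> 0 \<longrightarrow> even (card A))"
  unfolding grass_even_def by (subst span_gbasis) (auto dest: gcoeff_finite(2))

lemma grass_odd_iff: "a \<in> grass_odd \<longleftrightarrow> (\<forall>A. gcoeff a A \<noteq> 0 \<longrightarrow> odd (card A))"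
  unfolding grass_odd_def by (subst span_gbasis) (auto dest: gcoeff_finite(2))

lemma gbasis_mult:
  assumes "finite A" "finite B"
  shows "gbasis A * gbasis B
      = (if A \<inter> B = {} then gscale (gsign A B) (gbasis (A \<union> B)) else 0)"
proof (rule grassmann_eqI)
  fix C
  show "gcoeff (gbasis A * gbasis B) C
      = gcoeff (if A \<inter> B = {} then gscale (gsign A B) (gbasis (A \<union> B)) else 0) C"
  proof (cases "finite C")
    case False
    then show ?thesis using gcoeff_finite(2) by metis
  next
    case True
    have "gcoeff (gbasis A * gbasis B) C
        = (\<Sum>D\<in>Pow C. if D = A then
             (if C - A = B then gsign A B else 0) else 0)"
      unfolding times_grassmann.rep_eq
      by (rule sum.cong) (auto simp: gbasis.rep_eq assms)
    also have "\<dots> = (if A \<subseteq> C \<and> C - A = B then gsign A B else 0)"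
      using True by simp
    also have "A \<subseteq> C \<and> C - A = B \<longleftrightarrow> A \<inter> B = {} \<and> C = A \<union> B" by auto
    also have "(if A \<inter> B = {} \<and> C = A \<union> B then gsign A B else 0)
        = gcoeff (if A \<inter> B = {} then gscale (gsign A B) (gbasis (A \<union> B)) else 0) C"
      using assms by (simp add: gscale.rep_eq gbasis.rep_eq zero_grassmann.rep_eq)
    finally show ?thesis .
  qed
qed

lemma gbasis_empty: "gbasis {} = 1"
  by transfer auto

lemma gbasis_insert_less:
  assumes "finite A" "\<forall>a\<in>A. i < a"
  shows "gbasis (insert i A) = ggen i * gbasis A"
proof -
  have "{(a, b). a \<in> {i} \<and> b \<in> A \<and> b < a} = {}" "i \<notin> A" using assms by force+
  then have "gsign {i} A = (1 :: 'a)" by (simp only: gsign_def card.empty power_0)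
  then show ?thesis using assms \<open>i \<notin> A\<close>
    by (simp add: gbasis_mult module.scale_one[OF module_gscale])
qed

lemma ggen_square: "ggen i * ggen i = 0"
  by (simp add: gbasis_mult)

lemma ggen_anticommute: "ggen i * ggen j = - (ggen j * ggen i)"
proof -
  have s: "gsign {i} {j} = (if j < i then - 1 else 1 :: 'a)" for i j :: nat
  proof -
    have "{(a, b). a \<in> {i} \<and> b \<in> {j} \<and> b < a} = (if j < i then {(i, j)} else {})" by auto
    then show ?thesis unfolding gsign_def by simp
  qed
  have "gscale (- 1) a = - a" "gscale 1 a = a" for a :: "'a grassmann"
    by (transfer; simp)+
  then show ?thesis
    by (cases i j rule: linorder_cases) (auto simp: gbasis_mult s insert_commute)
qed

section \<open>The algebra of matrices and its identities\<close>

text \<open>The product of matrices is \<open>**\<close>; the product \<open>*\<close> on this type is componentwise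
  and is not used.\<close>

type_synonym 'k gmat = "'k grassmann ^ 2 ^ 2"

definition M11 :: "'k::comm_ring_1 gmat set" where
  "M11 = {X. X $ 1 $ 1 \<in> grass_even \<and> X $ 2 $ 2 \<in> grass_even \<and>
             X $ 1 $ 2 \<in> grass_odd \<and> X $ 2 $ 1 \<in> grass_odd}"

definition mscale :: "'k::comm_ring_1 \<Rightarrow> 'k gmat \<Rightarrow> 'k gmat" where
  "mscale c X = (\<chi> i j. gscale c (X $ i $ j))"

fun word_eval :: "('v \<Rightarrow> 'k::comm_ring_1 gmat) \<Rightarrow> 'v fmonoid \<Rightarrow> 'k gmat" where
  "word_eval \<sigma> (Word w) = foldr (\<lambda>v X. \<sigma> v ** X) w (mat 1)"

definition evaluate :: "('v \<Rightarrow> 'k::comm_ring_1 gmat) \<Rightarrow> ('v, 'k) free_alg \<Rightarrow> 'k gmat" where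
  "evaluate \<sigma> f =
     (\<Sum>w\<in>Poly_Mapping.keys f. mscale (Poly_Mapping.lookup f w) (word_eval \<sigma> w))"

definition identity_of :: "'k::comm_ring_1 gmat set \<Rightarrow> ('v, 'k) free_alg \<Rightarrow> bool" where
  "identity_of R f \<longleftrightarrow> (\<forall>\<sigma>. (\<forall>v. \<sigma> v \<in> R) \<longrightarrow> evaluate \<sigma> f = 0)"

lemma gcoeff_mult_nonzero:
  assumes "gcoeff (a * b) C \<noteq> 0"
  obtains A B where "gcoeff a A \<noteq> 0" "gcoeff b B \<noteq> 0" "card C = card A + card B"
proof -
  from assms obtain A where A: "A \<in> Pow C"
    "gsign A (C - A) * (gcoeff a A * gcoeff b (C - A)) \<noteq> 0"
    unfolding times_grassmann.rep_eq by (meson sum.neutral)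
  then have nz: "gcoeff a A \<noteq> 0" "gcoeff b (C - A) \<noteq> 0" by auto
  then have "finite A" "finite (C - A)" by (auto dest: gcoeff_finite(2))
  then have "card (A \<union> (C - A)) = card A + card (C - A)" by (rule card_Un_disjoint) auto
  moreover have "A \<union> (C - A) = C" using A by auto
  ultimately show ?thesis using nz that by simp
qed

lemma grass_parity_mult:
  "a \<in> grass_even \<Longrightarrow> b \<in> grass_even \<Longrightarrow> a * b \<in> grass_even"
  "a \<in> grass_odd \<Longrightarrow> b \<in> grass_odd \<Longrightarrow> a * b \<in> grass_even"
  "a \<in> grass_even \<Longrightarrow> b \<in> grass_odd \<Longrightarrow> a * b \<in> grass_odd"
  "a \<in> grass_odd \<Longrightarrow> b \<in> grass_even \<Longrightarrow> a * b \<in> grass_odd"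
  unfolding grass_even_iff grass_odd_iff by (metis gcoeff_mult_nonzero even_add)+

lemma grass_parity_add:
  "a \<in> grass_even \<Longrightarrow> b \<in> grass_even \<Longrightarrow> a + b \<in> grass_even"
  "a \<in> grass_odd \<Longrightarrow> b \<in> grass_odd \<Longrightarrow> a + b \<in> grass_odd"
  unfolding grass_even_def grass_odd_def by (rule module.span_add[OF module_gscale]; assumption)+

lemma M11_add: "X \<in> M11 \<Longrightarrow> Y \<in> M11 \<Longrightarrow> X + Y \<in> M11"
  by (simp add: M11_def grass_parity_add)

lemma M11_mult: "X \<in> M11 \<Longrightarrow> Y \<in> M11 \<Longrightarrow> X ** Y \<in> M11"
  by (simp add: M11_def matrix_matrix_mult_def sum_2 grass_parity_add grass_parity_mult)

lemma M11_one: "mat 1 \<in> M11"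
proof -
  have "(1 :: 'a grassmann) \<in> grass_even"
    by (auto simp: grass_even_iff one_grassmann.rep_eq split: if_splits)
  moreover have "(0 :: 'a grassmann) \<in> grass_odd"
    by (simp add: grass_odd_iff zero_grassmann.rep_eq)
  ultimately show ?thesis by (simp add: M11_def mat_def)
qed

lemma M11_mscale: "X \<in> M11 \<Longrightarrow> mscale c X \<in> M11"
  unfolding M11_def mscale_def grass_even_def grass_odd_def
  by (simp add: module.span_scale[OF module_gscale])

lemma mscale_simps:
  "mscale 0 X = 0" "mscale 1 X = X" "mscale (c + d) X = mscale c X + mscale d X"
  "mscale c (X + Y) = mscale c X + mscale c Y" "mscale c (mscale d X) = mscale (c * d) X"
  "mscale c 0 = 0"
  unfolding mscale_def vec_eq_iff
  by (simp_all add: module.scale_zero_left[OF module_gscale] module.scale_one[OF module_gscale]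
      module.scale_left_distrib[OF module_gscale] module.scale_right_distrib[OF module_gscale]
      module.scale_scale[OF module_gscale] module.scale_zero_right[OF module_gscale])

lemma mscale_mult:
  "mscale c X ** Y = mscale c (X ** Y)" "X ** mscale c Y = mscale c (X ** Y)"
  unfolding mscale_def matrix_matrix_mult_def vec_eq_iff
  by (simp_all add: gscale_mult module.scale_sum_right[OF module_gscale])

lemma evaluate_eq:
  assumes "finite F" "Poly_Mapping.keys f \<subseteq> F"
  shows "evaluate \<sigma> f = (\<Sum>w\<in>F. mscale (Poly_Mapping.lookup f w) (word_eval \<sigma> w))"
  unfolding evaluate_def
  by (rule sum.mono_neutral_left) (use assms in \<open>auto simp: in_keys_iff mscale_simps\<close>)

lemma evaluate_single: "evaluate \<sigma> (Poly_Mapping.single w c) = mscale c (word_eval \<sigma> w)"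
  by (subst evaluate_eq[of "{w}"]) (auto simp: lookup_single)

lemma evaluate_add: "evaluate \<sigma> (f + g) = evaluate \<sigma> f + evaluate \<sigma> g"
proof -
  let ?F = "Poly_Mapping.keys f \<union> Poly_Mapping.keys g"
  have "Poly_Mapping.keys (f + g) \<subseteq> ?F" by (rule Poly_Mapping.keys_add)
  then show ?thesis
    by (simp add: evaluate_eq[of ?F] lookup_add mscale_simps sum.distrib)
qed

lemma evaluate_one: "evaluate \<sigma> 1 = mat 1"
  using evaluate_single[of \<sigma> 0 1] by (simp add: zero_fmonoid_def[symmetric] mscale_simps)
    (simp add: zero_fmonoid_def)

lemma evaluate_var: "evaluate \<sigma> (var v) = \<sigma> v"
  by (simp add: var_def evaluate_single mscale_simps)

lemma word_eval_add: "word_eval \<sigma> (u + w) = word_eval \<sigma> u ** word_eval \<sigma> w"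
proof -
  have "foldr (\<lambda>v X. \<sigma> v ** X) us (foldr (\<lambda>v X. \<sigma> v ** X) ws (mat 1))
      = foldr (\<lambda>v X. \<sigma> v ** X) us (mat 1) ** foldr (\<lambda>v X. \<sigma> v ** X) ws (mat 1)" for us ws
    by (induction us) (simp_all add: matrix_mul_assoc)
  then show ?thesis by (cases u; cases w) (simp add: plus_fmonoid_def)
qed

lemma free_alg_induct [case_names zero single add]:
  assumes "P 0" "\<And>w c. P (Poly_Mapping.single w c)" "\<And>f g. P f \<Longrightarrow> P g \<Longrightarrow> P (f + g)"
  shows "P (f :: ('v, 'k::comm_ring_1) free_alg)"
proof (induction f rule: Poly_Mapping.update_induct)
  case const
  then show ?case by (rule assms)
next
  case (update f w c)
  then have "Poly_Mapping.update w c f = f + Poly_Mapping.single w c"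
    by (intro poly_mapping_eqI)
      (auto simp: lookup_update lookup_add lookup_single in_keys_iff when_def)
  then show ?case using assms update by simp
qed

lemma evaluate_mult: "evaluate \<sigma> (f * g) = evaluate \<sigma> f ** evaluate \<sigma> g"
proof (induction f rule: free_alg_induct)
  case zero
  show ?case by (simp add: evaluate_def)
next
  case (add f1 f2)
  then show ?case by (simp add: evaluate_add distrib_right matrix_matrix_mult_def vec_eq_iff sum.distrib)
next
  case (single u c)
  show ?case
  proof (induction g rule: free_alg_induct)
    case zero
    show ?case by (simp add: evaluate_def)
  next
    case (add g1 g2)
    then show ?case by (simp add: evaluate_add distrib_left matrix_add_ldistrib)
  next
    case (single w d)
    show ?case
      by (simp add: mult_single evaluate_single word_eval_add mscale_mult mscale_simps)
        (simp add: mult.commute)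
  qed
qed

end

theory Submission
  imports Defs "HOL-Computational_Algebra.Polynomial"
begin

text \<open>Let \<open>R\<close> be the quotient of \<open>K\<langle>x,y\<rangle>\<close> by the T-ideal generated by \<open>h\<close> and \<open>d\<close>, and \<open>c = [x,y]\<close>. In \<open>R\<close> the
  square of \<open>c\<close> is central and \<open>c\<^sup>3 = 0\<close>, so \<open>c\<^sup>2 r c = 0\<close> for all \<open>r\<close>. Linearizing \<open>h\<close> gives
  \<open>[x, c [x,w] + [x,w] c] = 0\<close>; with \<open>w\<close> a word times \<open>y\<close> this yields, by induction on the length, that
  \<open>c w c\<close> is central for every word \<open>w\<close>, and then \<open>c w c r c = r c\<^sup>2 w c = 0\<close>. Hence the elements
  \<open>x\<^sup>a y\<^sup>b\<close>, \<open>x\<^sup>a y\<^sup>b c x\<^sup>i y\<^sup>j\<close> and \<open>x\<^sup>a y\<^sup>b c x\<^sup>i y\<^sup>j c\<close> span \<open>R\<close>, since their span is closed under left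
  multiplication by \<open>x\<close> and \<open>y\<close>. No nontrivial combination of them is an identity of \<open>M\<^bsub>11\<^esub>(E)\<close>: evaluate at
  \<open>x = diag(s, u)\<close> and \<open>y = diag(t, v) + e\<^sub>0 E\<^bsub>12\<^esub> + e\<^sub>1 E\<^bsub>21\<^esub>\<close> with scalars \<open>s, t, u, v\<close> and compare the coefficients of
  \<open>1\<close>, \<open>e\<^sub>0\<close> and \<open>e\<^sub>0 e\<^sub>1\<close>, which are polynomials in \<open>s, t, u, v\<close>.\<close>

section \<open>Rings generated by two elements\<close>

lemma commutator_mult_right:
  "commutator a (b * c) = commutator a b * c + b * commutator (a::'a::ring) c"
  by (simp add: commutator_def algebra_simps)

lemma commutator_add_right:
  "commutator a (b + c) = commutator a b + commutator (a::'a::ring) c"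
  by (simp add: commutator_def algebra_simps)

lemma commutator_swap: "commutator b a = - commutator (a::'a::ring) b"
  by (simp add: commutator_def)

lemma commutator_self [simp]: "commutator a (a::'a::ring) = 0"
  by (simp add: commutator_def)

lemma commutator_one_right [simp]: "commutator a (1::'a::{ring,monoid_mult}) = 0"
  by (simp add: commutator_def)

lemma commutator_central_mult:
  assumes "\<And>r. z * r = r * (z::'a::ring)"
  shows "commutator a (z * b) = z * commutator a b" "commutator a (b * z) = commutator a b * z"
proof -
  have "a * (z * b) = z * (a * b)" by (simp only: mult.assoc[symmetric] assms[of a])
  then show "commutator a (z * b) = z * commutator a b"
    by (simp add: commutator_def algebra_simps)
  have "b * z * a = b * a * z" by (simp only: mult.assoc assms[of a])
  then show "commutator a (b * z) = commutator a b * z"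
    by (simp add: commutator_def algebra_simps)
qed

text \<open>\<open>central_if\<close> expresses that \<open>x\<close> and \<open>y\<close> generate
  the ring over central scalars; \<open>double_eq_0\<close> permits division of an equation by 2.
  The assumptions are symmetric in \<open>x\<close> and \<open>y\<close> up to the sign of the
  commutator, so that each fact about \<open>x\<close> transfers to \<open>y\<close>.\<close>

locale two_generated =
  fixes x y :: "'a::{ring,monoid_mult}"
  assumes square_x: "commutator ((commutator x w)\<^sup>2) x = 0"
    and square_y: "commutator ((commutator y w)\<^sup>2) y = 0"
    and cube: "(commutator x y) ^ 3 = 0"
    and double_eq_0: "r + r = (0::'a) \<Longrightarrow> r = 0"
    and central_if: "z * x = x * z \<Longrightarrow> z * y = y * z \<Longrightarrow> z * r = r * z"
begin

abbreviation c where "c \<equiv> commutator x y"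

lemma two_generated_swap: "two_generated y x"
proof
  have "(- c) ^ 3 = 0" using cube by (simp add: power3_eq_cube)
  then show "(commutator y x) ^ 3 = 0" by (simp add: commutator_swap[of y x])
  show "z * r = r * z" if "z * y = y * z" "z * x = x * z" for z r
    using that(2,1) by (rule central_if)
qed (fact square_x square_y double_eq_0)+

section \<open>The square of \<open>c\<close> and the centrality of \<open>c w c\<close>\<close>

lemma cube_mult: "c * (c * c) = 0"
  using cube by (simp add: power3_eq_cube mult.assoc)

lemma square_central: "c * c * r = r * (c * c)"
proof (rule central_if)
  show "c * c * x = x * (c * c)"
    using square_x[of y] by (simp add: commutator_def[of "_ * _"] power2_eq_square)
  show "c * c * y = y * (c * c)"
  proof -
    have "(commutator y x)\<^sup>2 = c * c" by (simp add: commutator_swap[of y x] power2_eq_square)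
    then show ?thesis using square_y[of x] by (simp add: commutator_def[of "_ * _"])
  qed
qed

lemma square_mult_eq_0: "c * c * r * c = 0" "c * r * (c * c) = 0"
proof -
  show "c * c * r * c = 0"
    using square_central[of r] cube_mult by (simp add: mult.assoc)
  show "c * r * (c * c) = 0"
  proof -
    have "c * r * (c * c) = c * c * (c * r)" by (rule square_central[symmetric])
    also have "\<dots> = c * (c * c) * r" by (simp only: mult.assoc)
    finally show ?thesis by (simp add: cube_mult)
  qed
qed

text \<open>Replacing \<open>w\<close> by \<open>y + w\<close> in \<open>square_x\<close> leaves
  only the mixed products, since the squares of \<open>c\<close> and of
  \<open>commutator x w\<close> already commute with \<open>x\<close>.\<close>

lemma square_x_linearized: "commutator x (c * commutator x w + commutator x w * c) = 0"
proof -
  have "commutator ((p + q)\<^sup>2) x = commutator (p\<^sup>2) x + commutator (q\<^sup>2) x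
      - commutator x (p * q + q * p)" for p q
    by (simp add: commutator_def power2_eq_square algebra_simps)
  from this[of c "commutator x w"] show ?thesis
    using square_x[of "y + w"] by (simp add: square_x commutator_add_right neg_eq_iff_add_eq_0)
qed

text \<open>Expanding \<^term>\<open>commutator x (prod_list ws)\<close> as a sum over the positions of \<open>y\<close> in the word
  \<open>ws\<close> shows that it lies in the ideal generated by \<^term>\<open>c\<close>.\<close>

lemma commutator_word_mult_square:
  "set ws \<subseteq> {x, y} \<Longrightarrow> commutator x (prod_list ws) * (c * c) = 0"
proof (induction ws)
  case (Cons a ws)
  have "c * prod_list ws * (c * c) = 0" by (rule square_mult_eq_0)
  then have "commutator x a * prod_list ws * (c * c) = 0"
    using Cons.prems by auto
  moreover have "a * commutator x (prod_list ws) * (c * c) = 0"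
    using Cons by (simp add: mult.assoc)
  ultimately show ?case by (simp add: commutator_mult_right distrib_right)
qed simp

text \<open>Setting of the induction step: sandwiches \<open>c w c\<close> of words \<open>w\<close>
  shorter than \<open>N\<close> are central, and the lemmas below lead up to words of length
  \<open>N\<close>.\<close>

context
  fixes N :: nat
  assumes IH: "\<And>ws r. set ws \<subseteq> {x, y} \<Longrightarrow> length ws < N \<Longrightarrow>
    c * prod_list ws * c * r = r * (c * prod_list ws * c)"
begin

lemma triple_eq_0:
  assumes "set ws \<subseteq> {x, y}" "length ws < N"
  shows "c * prod_list ws * c * r * c = 0" "c * r * c * prod_list ws * c = 0"
proof -
  have "c * prod_list ws * c * (r * c) = r * c * (c * prod_list ws * c)"
    by (rule IH[OF assms])
  also have "\<dots> = r * (c * c * prod_list ws * c)" by (simp add: mult.assoc)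
  also have "\<dots> = 0" by (simp only: square_mult_eq_0 mult_zero_right)
  finally show "c * prod_list ws * c * r * c = 0" by (simp add: mult.assoc)
  have "c * r * (c * prod_list ws * c) = c * prod_list ws * c * (c * r)"
    by (rule IH[OF assms, symmetric])
  also have "\<dots> = c * prod_list ws * (c * c) * r" by (simp add: mult.assoc)
  also have "\<dots> = 0" by (simp only: square_mult_eq_0 mult_zero_left)
  finally show "c * r * c * prod_list ws * c = 0" by (simp add: mult.assoc)
qed

text \<open>Each \<open>x\<close> in \<open>ws\<close> contributes, up to sign, a product
  \<open>c u' c w' c\<close> with short words, which vanishes by \<open>triple_eq_0\<close>. With
  \<open>us\<close> empty this moves a \<open>y\<close> across a sandwiched word.\<close>

lemma sandwich_commutator_y:
  assumes "set us \<subseteq> {x, y}" "set ws \<subseteq> {x, y}" "length us + length ws < N"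
  shows "c * prod_list us * commutator y (prod_list ws) * c = 0"
  using assms
proof (induction ws arbitrary: us)
  case (Cons a ws)
  have "c * prod_list us * commutator y a * prod_list ws * c = 0"
  proof -
    have "c * prod_list us * c * prod_list ws * c = 0"
      by (rule triple_eq_0) (use Cons.prems in auto)
    then show ?thesis using Cons.prems by (auto simp: commutator_swap[of y x])
  qed
  moreover have "c * prod_list (us @ [a]) * commutator y (prod_list ws) * c = 0"
    by (rule Cons.IH) (use Cons.prems in auto)
  ultimately show ?case
    by (simp add: commutator_mult_right distrib_left distrib_right mult.assoc)
qed simp

text \<open>The central factor \<open>c u c\<close> can be carried past the letters in front of each
  \<open>c\<close> that \<open>commutator x w\<close> produces; there \<open>c u c^2 = 0\<close>
  applies.\<close>

lemma central_mult_commutator: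
  assumes "set us \<subseteq> {x, y}" "length us < N" "set ws \<subseteq> {x, y}"
  shows "c * prod_list us * c * commutator x (prod_list ws) = 0"
  using assms(3)
proof (induction ws)
  case (Cons a ws)
  have "c * prod_list us * (c * c) = 0" by (rule square_mult_eq_0)
  then have "c * prod_list us * c * commutator x a * prod_list ws = 0"
    using Cons.prems by (auto simp: mult.assoc[symmetric])
  moreover have "c * prod_list us * c * (a * commutator x (prod_list ws))
      = a * (c * prod_list us * c * commutator x (prod_list ws))"
    by (simp only: mult.assoc[symmetric] IH[OF assms(1,2), of a])
  ultimately show ?case
    using Cons by (simp add: commutator_mult_right distrib_left mult.assoc)
qed simp

text \<open>Expanding the inner commutator gives terms \<open>c u' c w' t\<close>. The letter
  replaced by \<open>c\<close> is removed, so \<open>u'\<close> is shorter than \<open>N\<close>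
  even if the total length equals \<open>N\<close>; hence \<open>c u' c\<close> is central and
  \<open>central_mult_commutator\<close> kills the outer commutator.\<close>

lemma commutator_c_word_commutator_word:
  assumes "set us \<subseteq> {x, y}" "set ws \<subseteq> {x, y}" "set ts \<subseteq> {x, y}" "length us + length ws \<le> N"
  shows "commutator x (c * prod_list us * commutator x (prod_list ws) * prod_list ts) = 0"
  using assms(1,2,4)
proof (induction ws arbitrary: us)
  case (Cons a ws)
  have "commutator x (c * prod_list us * commutator x a * prod_list ws * prod_list ts) = 0"
  proof (cases "a = x")
    case False
    then have a: "a = y" using Cons.prems by auto
    have us: "set us \<subseteq> {x, y}" "length us < N" using Cons.prems by auto
    have "commutator x (c * prod_list us * c * prod_list (ws @ ts))
        = c * prod_list us * c * commutator x (prod_list (ws @ ts))"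
      by (rule commutator_central_mult) (rule IH[OF us])
    also have "\<dots> = 0"
      by (rule central_mult_commutator[OF us]) (use Cons.prems assms(3) in auto)
    finally show ?thesis by (simp add: a mult.assoc)
  qed (simp add: commutator_def[of x 0])
  moreover have "commutator x (c * prod_list (us @ [a]) * commutator x (prod_list ws) * prod_list ts) = 0"
    by (rule Cons.IH) (use Cons.prems in auto)
  ultimately show ?case
    by (simp add: commutator_mult_right[of x a] commutator_add_right distrib_left distrib_right mult.assoc)
qed (simp add: commutator_def[of x 0])

text \<open>Mirror image of the previous argument, with the central sandwich \<open>c w' y c\<close>
  on the right. The extra \<open>y\<close> lengthens the sandwiched word by one, hence the strict
  bound on \<open>ws\<close>.\<close>

lemma commutator_word_commutator_word_c:
  assumes "set us \<subseteq> {x, y}" "set ws \<subseteq> {x, y}" "length ws < N"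
  shows "commutator x (prod_list us * commutator x (prod_list ws) * y * c) = 0"
  using assms
proof (induction ws arbitrary: us)
  case (Cons a ws)
  have "commutator x (prod_list us * commutator x a * prod_list ws * y * c) = 0"
  proof (cases "a = x")
    case False
    then have a: "a = y" using Cons.prems by auto
    let ?vs = "ws @ [y]"
    have vs: "set ?vs \<subseteq> {x, y}" "length ?vs < N" using Cons.prems by auto
    have "commutator x (prod_list us * (c * prod_list ?vs * c))
        = commutator x (prod_list us) * (c * prod_list ?vs * c)"
      by (rule commutator_central_mult) (rule IH[OF vs])
    also have "\<dots> = c * prod_list ?vs * c * commutator x (prod_list us)"
      by (rule IH[OF vs, symmetric])
    also have "\<dots> = 0"
      by (rule central_mult_commutator[OF vs]) (use Cons.prems in auto)
    finally show ?thesis by (simp add: a mult.assoc)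
  qed (simp add: commutator_def[of x 0])
  moreover have "commutator x (prod_list (us @ [a]) * commutator x (prod_list ws) * y * c) = 0"
    by (rule Cons.IH) (use Cons.prems in auto)
  ultimately show ?case
    by (simp add: commutator_mult_right[of x a] commutator_add_right distrib_left distrib_right mult.assoc)
qed (simp add: commutator_def[of x 0])

lemma commutator_sandwich:
  assumes ws: "set ws \<subseteq> {x, y}" "length ws = N"
  shows "commutator x (c * prod_list ws * c) = 0"
proof (cases ws)
  case Nil
  then show ?thesis using square_central[of x] by (simp add: commutator_def[of x "_ * _"])
next
  case (Cons a vs)
  let ?w = "prod_list ws" and ?v = "prod_list vs"
  have vs: "set vs \<subseteq> {x, y}" "length vs < N" "set ws \<subseteq> {x, y}" using ws Cons by auto
  have 1: "commutator x (?w * (c * c)) = 0"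
    by (subst commutator_central_mult(2)[OF square_central])
      (rule commutator_word_mult_square[OF ws(1)])
  have 2: "commutator x (c * commutator x ?w * y) = 0"
    using commutator_c_word_commutator_word[of "[]" ws "[y]"] ws by simp
  have 3: "commutator x (a * commutator x ?v * y * c) = 0"
    using commutator_word_commutator_word_c[of "[a]" vs] vs ws Cons by simp
  \<comment> \<open>The linearized identity is used at \<open>w y\<close>, where
    \<open>[x, w y] = [x, w] y + w c\<close> brings in \<open>c w c\<close>.\<close>
  have "0 = commutator x (c * commutator x (?w * y) + commutator x (?w * y) * c)"
    by (rule square_x_linearized[symmetric])
  also have "\<dots> = commutator x (c * ?w * c) + commutator x (c * commutator x ?w * y)
      + commutator x (?w * (c * c)) + commutator x (commutator x ?w * y * c)"
    by (simp only: commutator_mult_right[of x "?w" y] distrib_left distrib_right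
        commutator_add_right mult.assoc add_ac)
  \<comment> \<open>Only the first letter can produce a sandwich of the full length
    \<open>N\<close>, namely \<open>c v y c\<close>, which the induction hypothesis does not cover;
    it is split off.\<close>
  also have "commutator x (commutator x ?w * y * c)
      = commutator x (commutator x a * ?v * y * c) + commutator x (a * commutator x ?v * y * c)"
    by (simp add: Cons commutator_mult_right[of x a] distrib_right commutator_add_right mult.assoc)
  finally have *: "commutator x (c * ?w * c) + commutator x (commutator x a * ?v * y * c) = 0"
    using 1 2 3 by simp
  show ?thesis
  proof (cases "a = x")
    case True
    then show ?thesis using * by (simp add: commutator_def[of x 0])
  next
    case False
    then have a: "a = y" using ws Cons by auto
    \<comment> \<open>The exceptional term thus equals \<open>c w c\<close>, and twice the desired
      commutator is zero.\<close>
    have "c * y * ?v * c = c * ?v * y * c"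
      using sandwich_commutator_y[of "[]" vs] vs
      by (simp add: commutator_def[of y] algebra_simps)
    then have "commutator x (c * ?w * c) + commutator x (c * ?w * c) = 0"
      using * by (simp add: a Cons mult.assoc)
    then show ?thesis by (rule double_eq_0)
  qed
qed

end

lemma sandwich_word_central:
  "set ws \<subseteq> {x, y} \<Longrightarrow> c * prod_list ws * c * r = r * (c * prod_list ws * c)"
proof (induction "length ws" arbitrary: ws r rule: less_induct)
  case less
  interpret swap: two_generated y x by (rule two_generated_swap)
  \<comment> \<open>Exchanging \<open>x\<close> and \<open>y\<close> turns \<open>c\<close> into
    \<open>-c\<close>; the two signs cancel in a sandwich.\<close>
  have *: "commutator y x * w * commutator y x = c * w * c" for w
    by (simp add: commutator_swap[of y x])
  have IH: "c * prod_list vs * c * t = t * (c * prod_list vs * c)"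
    if "set vs \<subseteq> {x, y}" "length vs < length ws" for vs t
    using less.hyps that by blast
  have "commutator x (c * prod_list ws * c) = 0"
    by (rule commutator_sandwich[OF IH less.prems refl])
  moreover have "commutator y (commutator y x * prod_list ws * commutator y x) = 0"
  proof (rule swap.commutator_sandwich)
    show "commutator y x * prod_list vs * commutator y x * t
        = t * (commutator y x * prod_list vs * commutator y x)"
      if "set vs \<subseteq> {y, x}" "length vs < length ws" for vs t
      unfolding * by (rule IH) (use that in auto)
  qed (use less.prems in auto)
  then have "commutator y (c * prod_list ws * c) = 0" unfolding * .
  ultimately have "c * prod_list ws * c * x = x * (c * prod_list ws * c)"
    "c * prod_list ws * c * y = y * (c * prod_list ws * c)"
    by (simp_all add: commutator_def[of _ "_ * _"])
  then show ?case by (rule central_if)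
qed

section \<open>Left multiplication of the standard elements by \<open>y\<close>\<close>

lemma sandwich_central: "c * (x ^ i * y ^ j) * c * r = r * (c * (x ^ i * y ^ j) * c)"
  using sandwich_word_central[of "replicate i x @ replicate j y" r]
  by (force simp: set_replicate_conv_if)

lemma sandwich_mult_eq_0: "c * (x ^ i * y ^ j) * c * r * c = 0"
  using triple_eq_0(1)[of "Suc (i + j)" "replicate i x @ replicate j y" r] sandwich_word_central
  by (force simp: set_replicate_conv_if)

text \<open>Each exchange of \<open>y\<close> with an \<open>x\<close> costs one term with
  \<open>c\<close>, because \<open>y x = x y - c\<close>.\<close>

lemma y_mult_power:
  "y * x ^ a = x ^ a * y - (\<Sum>k<a. x ^ k * c * x ^ (a - Suc k))"
proof (induction a)
  case (Suc a)
  have pow: "r * x ^ (a - Suc k) * x = r * x ^ (a - k)" if "k < a" for r k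
  proof -
    from that have "x ^ (a - k) = x ^ (a - Suc k) * x"
      by (simp add: power_Suc2[symmetric] Suc_diff_Suc del: power_Suc)
    then show ?thesis by (simp add: mult.assoc)
  qed
  have "y * x ^ Suc a = y * x ^ a * x" by (simp only: power_Suc2 mult.assoc)
  also have "\<dots> = x ^ a * (x * y - c) - (\<Sum>k<a. x ^ k * c * x ^ (a - Suc k) * x)"
    by (simp add: Suc commutator_def left_diff_distrib sum_distrib_right mult.assoc)
  also have "(\<Sum>k<a. x ^ k * c * x ^ (a - Suc k) * x) = (\<Sum>k<a. x ^ k * c * x ^ (a - k))"
    by (rule sum.cong) (simp_all add: pow)
  finally show ?case
    by (simp add: right_diff_distrib power_Suc2 mult.assoc del: power_Suc)
qed simp

text \<open>The terms with a new \<open>c\<close> remain standard: in the second equation they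
  contain a central sandwich, which is moved to the right end; in the third they contain
  \<open>c w c r c\<close> and vanish. The factor \<open>y ^ 0\<close> keeps the standard
  shape.\<close>

lemma y_mult_standard:
  "y * (x ^ a * y ^ b) = x ^ a * y ^ Suc b - (\<Sum>k<a. x ^ k * y ^ 0 * c * (x ^ (a - Suc k) * y ^ b))"
  "y * (x ^ a * y ^ b * c * (x ^ i * y ^ j)) = x ^ a * y ^ Suc b * c * (x ^ i * y ^ j)
    - (\<Sum>k<a. x ^ (k + i) * y ^ j * (c * (x ^ (a - Suc k) * y ^ b) * c))"
  "y * (x ^ a * y ^ b * (c * (x ^ i * y ^ j) * c)) = x ^ a * y ^ Suc b * (c * (x ^ i * y ^ j) * c)"
proof -
  \<comment> \<open>Here \<open>r\<close> is the tail of a standard element: \<open>1\<close>,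
    \<open>c w\<close> or \<open>c w c\<close>.\<close>
  have *: "y * (x ^ a * y ^ b * r) = x ^ a * y ^ Suc b * r
      - (\<Sum>k<a. x ^ k * (c * (x ^ (a - Suc k) * y ^ b) * r))" for r
  proof -
    have "y * (x ^ a * y ^ b * r) = y * x ^ a * (y ^ b * r)" by (simp only: mult.assoc)
    then show ?thesis
      by (simp add: y_mult_power left_diff_distrib sum_distrib_right mult.assoc)
  qed
  show "y * (x ^ a * y ^ b) = x ^ a * y ^ Suc b
      - (\<Sum>k<a. x ^ k * y ^ 0 * c * (x ^ (a - Suc k) * y ^ b))"
    using *[of 1] by (simp add: mult.assoc)
  have "x ^ k * (c * (x ^ m * y ^ b) * (c * (x ^ i * y ^ j)))
      = x ^ (k + i) * y ^ j * (c * (x ^ m * y ^ b) * c)" for k m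
  proof -
    have "x ^ k * (c * (x ^ m * y ^ b) * (c * (x ^ i * y ^ j)))
        = x ^ k * (c * (x ^ m * y ^ b) * c * (x ^ i * y ^ j))" by (simp only: mult.assoc)
    also have "\<dots> = x ^ k * (x ^ i * y ^ j * (c * (x ^ m * y ^ b) * c))"
      by (simp only: sandwich_central[of m b "x ^ i * y ^ j"])
    finally show ?thesis by (simp only: power_add mult.assoc)
  qed
  then show "y * (x ^ a * y ^ b * c * (x ^ i * y ^ j)) = x ^ a * y ^ Suc b * c * (x ^ i * y ^ j)
      - (\<Sum>k<a. x ^ (k + i) * y ^ j * (c * (x ^ (a - Suc k) * y ^ b) * c))"
    using *[of "c * (x ^ i * y ^ j)"] by (simp only: mult.assoc)
  have "c * (x ^ m * y ^ b) * (c * (x ^ i * y ^ j) * c) = 0" for m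
    using sandwich_mult_eq_0[of m b "x ^ i * y ^ j"] by (simp only: mult.assoc)
  then show "y * (x ^ a * y ^ b * (c * (x ^ i * y ^ j) * c))
      = x ^ a * y ^ Suc b * (c * (x ^ i * y ^ j) * c)"
    using *[of "c * (x ^ i * y ^ j) * c"] by simp
qed

end

section \<open>Linear combinations and substitutions\<close>

lemma poly_mapping_single_induct [case_names zero single add]:
  assumes "P 0" "\<And>i c. P (Poly_Mapping.single i c)" "\<And>f g. P f \<Longrightarrow> P g \<Longrightarrow> P (f + g)"
  shows "P (f :: 'i \<Rightarrow>\<^sub>0 'k::comm_monoid_add)"
proof (induction f rule: Poly_Mapping.update_induct)
  case const
  then show ?case by (rule assms)
next
  case (update f i c)
  then have "Poly_Mapping.update i c f = f + Poly_Mapping.single i c"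
    by (intro poly_mapping_eqI)
      (auto simp: lookup_update lookup_add lookup_single in_keys_iff when_def)
  then show ?case using assms update by simp
qed

lemma scalar_commute: "scalar k * f = f * scalar k"
  by (induction f rule: free_alg_induct)
    (simp_all add: scalar_def mult_single mult.commute distrib_left distrib_right)

lemma scalar_simps [simp]:
  "scalar 0 = 0" "scalar 1 = 1" "scalar (k + l) = scalar k + scalar l" "scalar (k * l) = scalar k * scalar l"
  by (simp_all add: scalar_def single_add mult_single)

text \<open>One operator serves two purposes: with standard elements as \<open>b\<close> it
  parametrizes their span, and with words as indices it extends a substitution linearly.\<close>

definition lin_comb ::
    "('i \<Rightarrow> ('v, 'k::comm_ring_1) free_alg) \<Rightarrow> ('i \<Rightarrow>\<^sub>0 'k) \<Rightarrow> ('v, 'k) free_alg" where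
  "lin_comb b p = (\<Sum>i\<in>Poly_Mapping.keys p. scalar (Poly_Mapping.lookup p i) * b i)"

lemma lin_comb_superset:
  assumes "finite F" "Poly_Mapping.keys p \<subseteq> F"
  shows "lin_comb b p = (\<Sum>i\<in>F. scalar (Poly_Mapping.lookup p i) * b i)"
  unfolding lin_comb_def
  by (rule sum.mono_neutral_left) (use assms in \<open>auto simp: in_keys_iff\<close>)

lemma lin_comb_zero [simp]: "lin_comb b 0 = 0"
  by (simp add: lin_comb_def)

lemma lin_comb_single [simp]: "lin_comb b (Poly_Mapping.single i k) = scalar k * b i"
  by (subst lin_comb_superset[of "{i}"]) (auto simp: lookup_single)

lemma lin_comb_add [simp]: "lin_comb b (p + q) = lin_comb b p + lin_comb b q"
proof -
  let ?F = "Poly_Mapping.keys p \<union> Poly_Mapping.keys q"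
  have "Poly_Mapping.keys (p + q) \<subseteq> ?F" by (rule Poly_Mapping.keys_add)
  then show ?thesis
    by (simp add: lin_comb_superset[of ?F] lookup_add distrib_right sum.distrib)
qed

definition substitute ::
    "('v \<Rightarrow> ('w, 'k::comm_ring_1) free_alg) \<Rightarrow> ('v, 'k) free_alg \<Rightarrow> ('w, 'k) free_alg" where
  "substitute s = lin_comb (\<lambda>w. prod_list (map s (letters w)))"

lemma substitute_mult:
  fixes s :: "'v \<Rightarrow> ('w, 'k::comm_ring_1) free_alg"
  shows "substitute s (f * g) = substitute s f * substitute s g"
proof (induction f rule: free_alg_induct)
  case (single u k)
  show ?case
  proof (induction g rule: free_alg_induct)
    case (single w l)
    have "scalar k * scalar l * (a * b) = scalar k * a * (scalar l * b)" for a b :: "('w, 'k) free_alg"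
      by (metis mult.assoc scalar_commute)
    then show ?case by (simp add: substitute_def mult_single plus_fmonoid_def)
  qed (simp_all add: substitute_def distrib_left)
qed (simp_all add: substitute_def distrib_right)

lemma substitute_one: "substitute s 1 = 1"
proof -
  have "substitute s (Poly_Mapping.single 0 1) = 1"
    unfolding substitute_def lin_comb_single by (simp add: zero_fmonoid_def)
  then show ?thesis by simp
qed

lemma substitute_var [simp]: "substitute s (var v) = s v"
  by (simp add: substitute_def var_def)

lemma substitute_commutator:
  "substitute s (commutator f g) = commutator (substitute s f) (substitute s g)"
proof -
  have "substitute s (a - b) + substitute s b = substitute s a" for a b
    unfolding substitute_def lin_comb_add[symmetric] by simp
  then show ?thesis unfolding commutator_def substitute_mult[symmetric] by (simp add: eq_diff_eq)
qed

lemma substitute_power: "substitute s (f ^ n) = substitute s f ^ n"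
  by (induction n) (simp_all add: substitute_one substitute_mult)

lemma algebra_endo_substitute: "algebra_endo (substitute s)"
proof -
  have "substitute s (scalar k) = scalar k" for k
    unfolding scalar_def substitute_def by (simp add: zero_fmonoid_def) (simp add: scalar_def zero_fmonoid_def)
  then show ?thesis
    unfolding algebra_endo_def by (simp add: substitute_one substitute_mult) (simp add: substitute_def)
qed

section \<open>The relatively free ring\<close>

definition hd_ideal :: "(xy, 'k::comm_ring_1) free_alg set" where
  "hd_ideal = T_ideal_generated
     {commutator ((commutator x_var y_var) ^ 2) x_var, (commutator x_var y_var) ^ 3}"

lemma
  fixes f g :: "(xy, 'k::comm_ring_1) free_alg"
  shows hd_ideal_zero: "(0 :: (xy, 'k) free_alg) \<in> hd_ideal"
  and hd_ideal_add: "f \<in> hd_ideal \<Longrightarrow> g \<in> hd_ideal \<Longrightarrow> f + g \<in> hd_ideal"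
  and hd_ideal_mult: "f \<in> hd_ideal \<Longrightarrow> r * f \<in> hd_ideal" "f \<in> hd_ideal \<Longrightarrow> f * r \<in> hd_ideal"
  and hd_ideal_substitute: "f \<in> hd_ideal \<Longrightarrow> substitute s f \<in> hd_ideal"
  using T_ideal_T_ideal_generated[of "{commutator ((commutator x_var y_var) ^ 2) x_var,
      (commutator x_var y_var) ^ 3 :: (xy, 'k) free_alg}"] algebra_endo_substitute[of s]
  unfolding hd_ideal_def[symmetric] T_ideal_def two_sided_ideal_def by blast+

lemma hd_ideal_uminus: "f \<in> hd_ideal \<Longrightarrow> - f \<in> hd_ideal"
  using hd_ideal_mult(1)[of f "-1"] by simp

text \<open>The endomorphism with \<open>x\<close> to \<open>f\<close> and \<open>y\<close> to
  \<open>g\<close> is applied to the generator. The generality supplies \<open>square_x\<close> and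
  \<open>square_y\<close> for all \<open>w\<close>.\<close>

lemma hd_ideal_square: "commutator ((commutator f g) ^ 2) f \<in> hd_ideal"
proof -
  have "commutator ((commutator x_var y_var) ^ 2) x_var \<in> hd_ideal"
    unfolding hd_ideal_def by (rule subsetD[OF T_ideal_generated_superset]) simp
  from hd_ideal_substitute[OF this, of "case_xy f g"] show ?thesis
    by (simp add: substitute_commutator substitute_power)
qed

lemma hd_ideal_cube: "(commutator x_var y_var) ^ 3 \<in> hd_ideal"
  unfolding hd_ideal_def by (rule subsetD[OF T_ideal_generated_superset]) simp

quotient_type (overloaded) 'k relfree = "(xy, 'k::comm_ring_1) free_alg" /
  "\<lambda>f g. f - g \<in> hd_ideal"
proof (rule equivpI)
  show "reflp (\<lambda>f g :: (xy, 'k) free_alg. f - g \<in> hd_ideal)"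
    by (simp add: reflp_def hd_ideal_zero)
  show "symp (\<lambda>f g :: (xy, 'k) free_alg. f - g \<in> hd_ideal)"
    unfolding symp_def using hd_ideal_uminus by fastforce
  show "transp (\<lambda>f g :: (xy, 'k) free_alg. f - g \<in> hd_ideal)"
    unfolding transp_def using hd_ideal_add by fastforce
qed

text \<open>The class \<open>ring_1\<close> would in addition demand \<open>0 \<noteq> 1\<close>,
  that is, that \<open>hd_ideal\<close> is a proper ideal.\<close>

instantiation relfree :: (comm_ring_1) "{ring, monoid_mult}"
begin

lift_definition zero_relfree :: "'a relfree" is 0 .
lift_definition one_relfree :: "'a relfree" is 1 .

lift_definition plus_relfree :: "'a relfree \<Rightarrow> 'a relfree \<Rightarrow> 'a relfree" is "(+)"
  using hd_ideal_add by (metis add_diff_add)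

lift_definition uminus_relfree :: "'a relfree \<Rightarrow> 'a relfree" is uminus
  using hd_ideal_uminus by fastforce

lift_definition minus_relfree :: "'a relfree \<Rightarrow> 'a relfree \<Rightarrow> 'a relfree" is "(-)"
proof -
  fix f f' g g' :: "(xy, 'a) free_alg"
  assume "f - f' \<in> hd_ideal" "g - g' \<in> hd_ideal"
  then have "(f - f') + - (g - g') \<in> hd_ideal" by (intro hd_ideal_add hd_ideal_uminus)
  then show "f - g - (f' - g') \<in> hd_ideal" by (simp add: algebra_simps)
qed

lift_definition times_relfree :: "'a relfree \<Rightarrow> 'a relfree \<Rightarrow> 'a relfree" is "(*)"
proof -
  fix f f' g g' :: "(xy, 'a) free_alg"
  assume "f - f' \<in> hd_ideal" "g - g' \<in> hd_ideal"
  then have "(f - f') * g + f' * (g - g') \<in> hd_ideal" by (intro hd_ideal_add hd_ideal_mult)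
  then show "f * g - f' * g' \<in> hd_ideal" by (simp add: algebra_simps)
qed

instance
  by standard (transfer; simp add: hd_ideal_zero algebra_simps)+

end

lemma abs_relfree_hom:
  "abs_relfree (f + g) = abs_relfree f + abs_relfree g"
  "abs_relfree (f - g) = abs_relfree f - abs_relfree g"
  "abs_relfree (f * g) = abs_relfree f * abs_relfree g"
  "abs_relfree 0 = 0" "abs_relfree 1 = 1"
  by (transfer; simp add: hd_ideal_zero)+

lemma abs_relfree_power: "abs_relfree (f ^ n) = abs_relfree f ^ n"
  by (induction n) (simp_all add: abs_relfree_hom)

lemma abs_relfree_commutator:
  "abs_relfree (commutator f g) = commutator (abs_relfree f) (abs_relfree g)"
  by (simp add: commutator_def abs_relfree_hom)

lemma abs_relfree_eq_0: "abs_relfree f = 0 \<longleftrightarrow> f \<in> hd_ideal"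
  by transfer simp

lemma relfree_cases: obtains f where "r = abs_relfree f"
  by (metis Quotient3_abs_rep[OF Quotient3_relfree])

lemma free_alg_var_induct [case_names one var scalar add]:
  assumes one: "P 1" and var: "\<And>v f. P f \<Longrightarrow> P (var v * f)"
    and scalar: "\<And>k f. P f \<Longrightarrow> P (scalar k * f)" and add: "\<And>f g. P f \<Longrightarrow> P g \<Longrightarrow> P (f + g)"
  shows "P (f :: ('v, 'k::comm_ring_1) free_alg)"
proof (induction f rule: free_alg_induct)
  case zero
  show ?case using scalar[OF one, of 0] by simp
next
  case (single w k)
  have "P (Poly_Mapping.single (Word u) 1)" for u
  proof (induction u)
    case Nil
    have "Poly_Mapping.single (Word []) 1 = (1 :: ('v, 'k) free_alg)"
      unfolding zero_fmonoid_def[symmetric] by simp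
    then show ?case using one by simp
  qed (simp add: single_Cons var)
  from scalar[OF this, of k "letters w"] show ?case by (simp add: scalar_mult_single)
qed (rule add)

interpretation relfree:
  two_generated "abs_relfree x_var :: 'k::field_char_0 relfree" "abs_relfree y_var"
proof
  have sq: "commutator ((commutator r s)\<^sup>2) r = 0" for r s :: "'k relfree"
  proof -
    obtain f g where "r = abs_relfree f" "s = abs_relfree g" by (metis relfree_cases)
    then show ?thesis using hd_ideal_square[of f g]
      by (simp add: abs_relfree_eq_0[symmetric] abs_relfree_commutator abs_relfree_power)
  qed
  then show "commutator ((commutator (abs_relfree x_var) s)\<^sup>2) (abs_relfree x_var) = 0"
    "commutator ((commutator (abs_relfree y_var) s)\<^sup>2) (abs_relfree y_var) = 0" for s :: "'k relfree"
    by auto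
  show "(commutator (abs_relfree x_var) (abs_relfree y_var)) ^ 3 = (0 :: 'k relfree)"
    using hd_ideal_cube
    by (simp add: abs_relfree_eq_0[symmetric] abs_relfree_commutator abs_relfree_power)
  show "r = 0" if "r + r = 0" for r :: "'k relfree"
  proof -
    \<comment> \<open>Characteristic 0 enters here: one half exists.\<close>
    have "1 = scalar (1 / 2) + scalar (1 / 2 :: 'k)"
      by (simp add: scalar_simps(3)[symmetric] del: scalar_simps(3))
    then have "1 = abs_relfree (scalar (1 / 2 :: 'k)) + abs_relfree (scalar (1 / 2))"
      unfolding abs_relfree_hom[symmetric] by (rule arg_cong)
    then have "r = (abs_relfree (scalar (1 / 2)) + abs_relfree (scalar (1 / 2))) * r"
      by simp
    also have "\<dots> = abs_relfree (scalar (1 / 2)) * (r + r)" by (simp add: algebra_simps)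
    finally show ?thesis using that by simp
  qed
  show "z * r = r * z" if z: "z * abs_relfree x_var = abs_relfree x_var * z"
    "z * abs_relfree y_var = abs_relfree y_var * z" for z r :: "'k relfree"
  proof -
    have var: "z * abs_relfree (var v) = abs_relfree (var v) * z" for v
      by (cases v) (use z in auto)
    obtain g where g: "z = abs_relfree g" by (rule relfree_cases)
    have scalar: "z * abs_relfree (scalar k) = abs_relfree (scalar k) * z" for k
      unfolding g abs_relfree_hom[symmetric] scalar_commute ..
    \<comment> \<open>The centralizer of \<open>z\<close> is a subring containing the scalars and
      both variables, hence everything.\<close>
    have "z * abs_relfree f = abs_relfree f * z" for f
    proof (induction f rule: free_alg_var_induct)
      case (var v f)
      then show ?case using \<open>z * abs_relfree (var v) = abs_relfree (var v) * z\<close>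
        by (simp add: abs_relfree_hom) (metis mult.assoc)
    next
      case (scalar k f)
      then show ?case using \<open>z * abs_relfree (scalar k) = abs_relfree (scalar k) * z\<close>
        by (simp add: abs_relfree_hom) (metis mult.assoc)
    qed (simp_all add: abs_relfree_hom distrib_left distrib_right)
    then show ?thesis by (metis relfree_cases)
  qed
qed

section \<open>The standard elements span the quotient\<close>

datatype std_index = Std0 nat nat | Std1 nat nat nat nat | Std2 nat nat nat nat

text \<open>The constructors count the occurrences of \<open>c\<close>. In \<open>Std2\<close> the
  bracket is a sandwich, central modulo \<open>hd_ideal\<close>.\<close>

fun std :: "std_index \<Rightarrow> (xy, 'k::comm_ring_1) free_alg" where
  "std (Std0 a b) = x_var ^ a * y_var ^ b"
| "std (Std1 a b i j) = x_var ^ a * y_var ^ b * commutator x_var y_var * (x_var ^ i * y_var ^ j)"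
| "std (Std2 a b i j) = x_var ^ a * y_var ^ b *
     (commutator x_var y_var * (x_var ^ i * y_var ^ j) * commutator x_var y_var)"

definition std_span :: "'k::comm_ring_1 relfree set" where
  "std_span = range (\<lambda>p. abs_relfree (lin_comb std p))"

lemma std_span_scaled_std: "abs_relfree (scalar k * std i) \<in> std_span"
  unfolding std_span_def by (rule range_eqI[of _ _ "Poly_Mapping.single i k"]) simp

lemma std_span_std: "abs_relfree (std i) \<in> std_span"
  using std_span_scaled_std[of 1 i] by simp

lemma std_span_zero: "0 \<in> std_span"
  using std_span_scaled_std[of 0] by (simp add: abs_relfree_hom)

lemma std_span_add: "r \<in> std_span \<Longrightarrow> s \<in> std_span \<Longrightarrow> r + s \<in> std_span"
  unfolding std_span_def by (auto simp: abs_relfree_hom[symmetric] lin_comb_add[symmetric] simp del: lin_comb_add)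

lemma std_span_scalar:
  assumes "r \<in> std_span"
  shows "abs_relfree (scalar k) * r \<in> std_span"
proof -
  have "abs_relfree (scalar k) * abs_relfree (lin_comb std p) \<in> std_span" for p
    by (induction p rule: poly_mapping_single_induct)
      (simp_all add: abs_relfree_hom std_span_zero distrib_left std_span_add,
       metis abs_relfree_hom(3) mult.assoc scalar_simps(4) std_span_scaled_std)
  then show ?thesis using assms by (auto simp: std_span_def)
qed

lemma std_span_diff:
  fixes r s :: "'k::comm_ring_1 relfree"
  assumes "r \<in> std_span" "s \<in> std_span"
  shows "r - s \<in> std_span"
proof -
  have "abs_relfree (scalar 1) + abs_relfree (scalar (- 1)) = (0 :: 'k relfree)"
    by (simp only: abs_relfree_hom(1)[symmetric] scalar_simps(3)[symmetric])
      (simp add: abs_relfree_hom)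
  then have "s + abs_relfree (scalar (- 1)) * s = 0"
    by (metis abs_relfree_hom(5) distrib_right mult_1 mult_zero_left scalar_simps(2))
  moreover have "r + abs_relfree (scalar (- 1)) * s \<in> std_span"
    by (intro std_span_add std_span_scalar assms)
  ultimately show ?thesis by (metis add_eq_0_iff2 diff_conv_add_uminus minus_equation_iff)
qed

lemma std_span_sum: "(\<And>i. i \<in> A \<Longrightarrow> r i \<in> std_span) \<Longrightarrow> sum r A \<in> std_span"
  by (induction A rule: infinite_finite_induct) (auto simp: std_span_zero std_span_add)

text \<open>Multiplication by \<open>x\<close> raises an exponent; multiplication by
  \<open>y\<close> is \<open>y_mult_standard\<close>.\<close>

lemma std_span_var_mult:
  fixes r :: "'k::field_char_0 relfree"
  assumes "r \<in> std_span"
  shows "abs_relfree (var v) * r \<in> std_span"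
proof -
  let ?x = "abs_relfree x_var :: 'k relfree" and ?y = "abs_relfree y_var :: 'k relfree"
  let ?c = "commutator ?x ?y"
  have std: "?x ^ a * ?y ^ b \<in> std_span" "?x ^ a * ?y ^ b * ?c * (?x ^ i * ?y ^ j) \<in> std_span"
    "?x ^ a * ?y ^ b * (?c * (?x ^ i * ?y ^ j) * ?c) \<in> std_span" for a b i j
    using std_span_std[of "Std0 a b"] std_span_std[of "Std1 a b i j"] std_span_std[of "Std2 a b i j"]
    by (simp_all add: abs_relfree_hom abs_relfree_power abs_relfree_commutator)
  have x: "?x * (?x ^ a * r) = ?x ^ Suc a * r" for a r by (simp add: mult.assoc)
  have "?x * abs_relfree (std i) \<in> std_span" for i
  proof (cases i)
    case (Std1 a b i j)
    then show ?thesis using std(2)[of "Suc a" b i j]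
      by (simp add: abs_relfree_hom abs_relfree_power abs_relfree_commutator mult.assoc)
  qed (use std(1)[of "Suc _"] std(3)[of "Suc _"] in
      \<open>simp_all add: abs_relfree_hom abs_relfree_power abs_relfree_commutator mult.assoc\<close>)
  moreover have "?y * abs_relfree (std i) \<in> std_span" for i
    by (cases i) (auto simp only: std.simps abs_relfree_hom abs_relfree_power abs_relfree_commutator
        relfree.y_mult_standard intro!: std_span_diff std_span_sum std)
  ultimately have var: "abs_relfree (var v) * abs_relfree (std i :: (xy, 'k) free_alg) \<in> std_span" for i
    by (cases v) auto
  have "abs_relfree (var v) * abs_relfree (lin_comb std p) \<in> std_span" for p :: "std_index \<Rightarrow>\<^sub>0 'k"
  proof (induction p rule: poly_mapping_single_induct)
    case (single i k)
    have "var v * (scalar k * std i) = scalar k * (var v * std i)"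
      by (simp only: mult.assoc[symmetric] scalar_commute[of k "var v"])
    then have "abs_relfree (var v) * abs_relfree (lin_comb std (Poly_Mapping.single i k))
        = abs_relfree (scalar k) * (abs_relfree (var v) * abs_relfree (std i))"
      by (simp only: abs_relfree_hom(3)[symmetric] lin_comb_single)
    then show ?case using std_span_scalar[OF var] by metis
  qed (simp_all add: abs_relfree_hom std_span_zero distrib_left std_span_add)
  then show ?thesis using assms by (auto simp: std_span_def)
qed

text \<open>A subspace that contains 1 and is stable under left multiplication by both variables
  contains the image of every word.\<close>

lemma std_span_eq: "std_span = (UNIV :: 'k::field_char_0 relfree set)"
proof -
  have "abs_relfree f \<in> std_span" for f :: "(xy, 'k) free_alg"
  proof (induction f rule: free_alg_var_induct)
    case one
    show ?case using std_span_std[of "Std0 0 0"] by simp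
  qed (simp_all add: abs_relfree_hom std_span_add std_span_scalar std_span_var_mult)
  then show ?thesis by (metis UNIV_eq_I relfree_cases)
qed

lemma hd_ideal_standard_form:
  fixes f :: "(xy, 'k::field_char_0) free_alg"
  obtains p where "f - lin_comb std p \<in> hd_ideal"
proof -
  have "abs_relfree f \<in> std_span" by (simp add: std_span_eq)
  then obtain p where "abs_relfree f = abs_relfree (lin_comb std p)" by (auto simp: std_span_def)
  then show ?thesis by (intro that) (simp add: abs_relfree_eq_0[symmetric] abs_relfree_hom)
qed

section \<open>Supercommutativity and the identities of \<open>M\<^bsub>11\<^esub>(E)\<close>\<close>

text \<open>Each pair in \<open>A \<times> B\<close> is an inversion for exactly one of the two
  orders of the factors, so the two inversion counts add up to
  \<open>card A * card B\<close>.\<close>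

lemma gsign_swap:
  assumes "finite A" "finite B" "A \<inter> B = {}"
  shows "gsign A B = ((- 1) ^ (card A * card B) * gsign B A :: 'k::comm_ring_1)"
proof -
  let ?I = "{(a, b). a \<in> A \<and> b \<in> B \<and> b < a}" and ?J = "{(b, a). b \<in> B \<and> a \<in> A \<and> a < b}"
  have "A \<times> B = ?I \<union> prod.swap ` ?J"
    using assms(3) by (auto simp: image_iff disjoint_iff not_less_iff_gr_or_eq)
  moreover have "?I \<inter> prod.swap ` ?J = {}" by auto
  moreover have "finite ?I" "finite ?J" by (rule finite_inversions; fact)+
  ultimately have "card (A \<times> B) = card ?I + card (prod.swap ` ?J)"
    by (simp add: card_Un_disjoint)
  then have "card A * card B = card ?I + card ?J"
    by (simp add: card_cartesian_product card_image)
  then show ?thesis by (simp add: gsign_def power_add mult.assoc)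
qed

text \<open>Passing to complements in \<open>C\<close> writes \<open>b * a\<close> over the same
  splittings as \<open>a * b\<close>. If \<open>a\<close> is even, or both factors are odd, the
  extra sign is the same in all nonzero terms.\<close>

lemma gcoeff_mult_swap:
  assumes "finite C"
  shows "gcoeff (b * a) C
    = (\<Sum>A\<in>Pow C. (- 1) ^ (card A * card (C - A)) * (gsign A (C - A) * (gcoeff a A * gcoeff b (C - A))))"
proof -
  have "gcoeff (b * a) C = (\<Sum>A\<in>Pow C. gsign (C - A) (C - (C - A)) * (gcoeff b (C - A) * gcoeff a (C - (C - A))))"
    unfolding times_grassmann.rep_eq
    by (rule sum.reindex_bij_witness[where i = "\<lambda>A. C - A" and j = "\<lambda>A. C - A"]) (auto simp: double_diff)
  also have "\<dots> = (\<Sum>A\<in>Pow C. (- 1) ^ (card A * card (C - A)) * (gsign A (C - A) * (gcoeff a A * gcoeff b (C - A))))"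
  proof (rule sum.cong)
    fix A assume "A \<in> Pow C"
    then have A: "C - (C - A) = A" "finite A" "finite (C - A)"
      using assms by (auto intro: finite_subset)
    have "gsign (C - A) A = ((- 1) ^ (card (C - A) * card A) * gsign A (C - A) :: 'a)"
      by (rule gsign_swap) (use A in auto)
    then show "gsign (C - A) (C - (C - A)) * (gcoeff b (C - A) * gcoeff a (C - (C - A)))
      = (- 1) ^ (card A * card (C - A)) * (gsign A (C - A) * (gcoeff a A * gcoeff b (C - A)))"
      using A by (simp add: ac_simps)
  qed simp
  finally show ?thesis .
qed

lemma grass_even_commute:
  assumes "a \<in> grass_even"
  shows "a * b = b * a"
proof (rule grassmann_eqI)
  fix C
  show "gcoeff (a * b) C = gcoeff (b * a) C"
  proof (cases "finite C")
    case True
    show ?thesis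
      unfolding gcoeff_mult_swap[OF True, of b] times_grassmann.rep_eq[of a]
      by (rule sum.cong) (use assms in \<open>force simp: grass_even_iff uminus_power_if\<close>)+
  qed (metis gcoeff_finite(2))
qed

lemma grass_odd_anticommute:
  assumes "p \<in> grass_odd" "q \<in> grass_odd"
  shows "p * q = - (q * p)"
proof (rule grassmann_eqI)
  fix C
  show "gcoeff (p * q) C = gcoeff (- (q * p)) C"
  proof (cases "finite C")
    case True
    show ?thesis
      unfolding uminus_grassmann.rep_eq gcoeff_mult_swap[OF True, of q] times_grassmann.rep_eq[of p]
        sum_negf[symmetric]
      by (rule sum.cong) (use assms in \<open>force simp: grass_odd_iff uminus_power_if\<close>)+
  qed (metis gcoeff_finite(2))
qed

lemma grass_odd_square:
  fixes p :: "'k::field_char_0 grassmann"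
  assumes "p \<in> grass_odd"
  shows "p * p = 0"
proof (rule grassmann_eqI)
  fix A
  have "gcoeff (p * p) A = - gcoeff (p * p) A"
    by (metis grass_odd_anticommute[OF assms assms] uminus_grassmann.rep_eq)
  then show "gcoeff (p * p) A = gcoeff 0 A" by (simp add: zero_grassmann.rep_eq)
qed

section \<open>Commutators in \<open>M11\<close>\<close>

lemma mat2_mult:
  fixes A B :: "'a::semiring_1 ^ 2 ^ 2"
  shows "(A ** B) $ i $ j = A $ i $ 1 * B $ 1 $ j + A $ i $ 2 * B $ 2 $ j"
  by (simp add: matrix_matrix_mult_def sum_2)

lemma mat2_eqI:
  fixes A B :: "'a ^ 2 ^ 2"
  assumes "A $ 1 $ 1 = B $ 1 $ 1" "A $ 1 $ 2 = B $ 1 $ 2" "A $ 2 $ 1 = B $ 2 $ 1" "A $ 2 $ 2 = B $ 2 $ 2"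
  shows "A = B"
  using assms by (simp add: vec_eq_iff forall_2)

text \<open>For two matrices of \<^const>\<open>M11\<close> with off-diagonal entries \<open>p\<close>, \<open>q\<close> and \<open>r\<close>, \<open>s\<close> and with
  diagonals of differences \<open>u\<close> and \<open>v\<close>, the commutator has diagonal entries \<open>z\<close>, \<open>z\<close> and off-diagonal
  entries \<open>w1\<close>, \<open>w2\<close>.\<close>

context
  fixes u v p q r s z w1 w2 :: "'a::ring_1"
  assumes central: "u * t = t * u" "v * t = t * v"
    and odd: "p * p = 0" "q * q = 0" "r * r = 0" "s * s = 0"
      "q * p = - (p * q)" "r * p = - (p * r)" "s * p = - (p * s)"
      "r * q = - (q * r)" "s * q = - (q * s)" "s * r = - (r * s)"
    and entries: "z = p * s + q * r" "w1 = u * r - v * p" "w2 = v * q - u * s"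
begin

lemma odd_left:
  "p * (p * t) = 0" "q * (q * t) = 0" "r * (r * t) = 0" "s * (s * t) = 0"
  "q * (p * t) = - (p * (q * t))" "r * (p * t) = - (p * (r * t))" "s * (p * t) = - (p * (s * t))"
  "r * (q * t) = - (q * (r * t))" "s * (q * t) = - (q * (s * t))" "s * (r * t) = - (r * (s * t))"
  by (simp_all only: mult.assoc[symmetric] odd mult_minus_left mult_zero_left)

lemma central_left:
  "p * u = u * p" "q * u = u * q" "r * u = u * r" "s * u = u * s"
  "p * v = v * p" "q * v = v * q" "r * v = v * r" "s * v = v * s" "v * u = u * v"
  "p * (u * t) = u * (p * t)" "q * (u * t) = u * (q * t)" "r * (u * t) = u * (r * t)" "s * (u * t) = u * (s * t)"
  "p * (v * t) = v * (p * t)" "q * (v * t) = v * (q * t)" "r * (v * t) = v * (r * t)" "s * (v * t) = v * (s * t)"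
  "v * (u * t) = u * (v * t)"
  by (metis central mult.assoc)+

lemmas normalize = entries algebra_simps odd odd_left central_left

text \<open>After \<open>entries\<close> is inserted, central factors move to the front and odd
  letters are sorted as \<open>p\<close>, \<open>q\<close>, \<open>r\<close>, \<open>s\<close>; a
  repeated odd letter gives zero. These relations suffice to compare the entries in
  \<open>M11_commutator_identities\<close>.\<close>

lemma commutator_entries:
  "u * (z * w1) = w1 * (w2 * p)" "u * (z * w2) = w1 * (w2 * q)" "z * (w1 * q) = z * (p * w2)"
  "z * (z * z) = 0" "z * (w1 * w2) = 0" "z * (z * w1) = 0" "z * (z * w2) = 0"
  "w1 * z = z * w1" "w2 * z = z * w2" "p * z = z * p" "q * z = z * q"
  "w2 * w1 = - (w1 * w2)" "w1 * (w1 * w2) = 0" "w2 * (w1 * w2) = 0"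
  "p * (w1 * w2) = w1 * (w2 * p)" "q * (w1 * w2) = w1 * (w2 * q)"
  "w2 * p = - (p * w2)" "q * w1 = - (w1 * q)"
  by (simp_all add: normalize)

end

lemma M11_commutator_identities:
  fixes X Y :: "'k::field_char_0 gmat"
  assumes "X \<in> M11" "Y \<in> M11"
  defines "C \<equiv> X ** Y - Y ** X"
  shows "C ** C ** X = X ** (C ** C)" "C ** (C ** C) = 0"
proof -
  define p q r s where pqrs: "p = X $ 1 $ 2" "q = X $ 2 $ 1" "r = Y $ 1 $ 2" "s = Y $ 2 $ 1"
  define a b where ab: "a = X $ 1 $ 1" "b = X $ 2 $ 2"
  define v where v: "v = Y $ 1 $ 1 - Y $ 2 $ 2"
  have comm: "g * t = t * g" if "g \<in> {a, b, Y $ 1 $ 1, Y $ 2 $ 2}" for g t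
    using that assms by (intro grass_even_commute) (auto simp: M11_def ab)
  have central: "(a - b) * t = t * (a - b)" "v * t = t * v" for t
    using comm[of a t] comm[of b t] comm[of "Y $ 1 $ 1" t] comm[of "Y $ 2 $ 2" t]
    by (simp_all add: v left_diff_distrib right_diff_distrib)
  have "p \<in> grass_odd" "q \<in> grass_odd" "r \<in> grass_odd" "s \<in> grass_odd"
    using assms by (simp_all add: M11_def pqrs)
  note odd = this[THEN grass_odd_square] grass_odd_anticommute[OF this(2,1)]
    grass_odd_anticommute[OF this(3,1)] grass_odd_anticommute[OF this(4,1)]
    grass_odd_anticommute[OF this(3,2)] grass_odd_anticommute[OF this(4,2)]
    grass_odd_anticommute[OF this(4,3)]
  define z w1 w2 where zw: "z = p * s + q * r" "w1 = (a - b) * r - v * p" "w2 = v * q - (a - b) * s"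
  note ids = commutator_entries[OF central odd zw]
  have C: "C $ 1 $ 1 = z" "C $ 1 $ 2 = w1" "C $ 2 $ 1 = w2" "C $ 2 $ 2 = z"
    unfolding C_def zw v
    using comm[of a "Y $ 1 $ 1"] comm[of b "Y $ 2 $ 2"] comm[of b r] comm[of "Y $ 1 $ 1" p]
      comm[of "Y $ 2 $ 2" p] comm[of a s] comm[of "Y $ 1 $ 1" q] comm[of "Y $ 2 $ 2" q]
    by (simp_all add: mat2_mult pqrs[symmetric] ab[symmetric] odd algebra_simps)
  have diag: "t * a = a * t" "t * b = b * t" for t using comm[of a t] comm[of b t] by simp_all
  \<comment> \<open>The off-diagonal entries of \<open>C^2 X\<close> and \<open>X C^2\<close> differ
    by twice the difference of the two sides.\<close>
  have eqs: "a * (z * w1) = w1 * (w2 * p) + b * (z * w1)" "a * (z * w2) = w1 * (w2 * q) + b * (z * w2)"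
    using ids(1,2) by (simp_all add: left_diff_distrib diff_eq_eq)
  have CC: "(C ** C) $ 1 $ 1 = z * z + w1 * w2" "(C ** C) $ 1 $ 2 = z * w1 + z * w1"
    "(C ** C) $ 2 $ 1 = z * w2 + z * w2" "(C ** C) $ 2 $ 2 = z * z - w1 * w2"
    by (simp_all add: mat2_mult C ids)
  have swap: "w1 * (z * t) = z * (w1 * t)" "w2 * (z * t) = z * (w2 * t)"
    "p * (z * t) = z * (p * t)" "q * (z * t) = z * (q * t)" for t
    by (simp_all only: mult.assoc[symmetric] ids(8-11))
  show "C ** (C ** C) = 0"
    by (rule mat2_eqI; simp add: mat2_mult[of C "C ** C"] C CC distrib_left right_diff_distrib swap ids)
  note simps = mat2_mult[of "C ** C" X] mat2_mult[of X "C ** C"] CC pqrs[symmetric] ab[symmetric]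
    distrib_left distrib_right left_diff_distrib right_diff_distrib
    mult.assoc swap ids diag[of "z * z", unfolded mult.assoc] diag[of "w1 * w2", unfolded mult.assoc]
    diag[of "z * w1", unfolded mult.assoc] diag[of "z * w2", unfolded mult.assoc] eqs
  show "C ** C ** X = X ** (C ** C)"
    by (rule mat2_eqI; simp add: simps)
qed

section \<open>Evaluation and the T-ideal of identities\<close>

lemma evaluate_zero [simp]: "evaluate \<sigma> 0 = 0"
  by (simp add: evaluate_def)

lemma evaluate_diff: "evaluate \<sigma> (f - g) = evaluate \<sigma> f - evaluate \<sigma> g"
  using evaluate_add[of \<sigma> "f - g" g] by simp

lemma evaluate_sum: "evaluate \<sigma> (\<Sum>i\<in>A. f i) = (\<Sum>i\<in>A. evaluate \<sigma> (f i))"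
  by (induction A rule: infinite_finite_induct) (simp_all add: evaluate_add)

lemma evaluate_scalar_mult: "evaluate \<sigma> (scalar k * f) = mscale k (evaluate \<sigma> f)"
  by (simp add: scalar_def evaluate_mult evaluate_single mscale_mult zero_fmonoid_def)

lemma evaluate_commutator:
  "evaluate \<sigma> (commutator f g) = evaluate \<sigma> f ** evaluate \<sigma> g - evaluate \<sigma> g ** evaluate \<sigma> f"
  by (simp add: commutator_def evaluate_diff evaluate_mult)

lemma evaluate_M11: "(\<And>v. \<sigma> v \<in> M11) \<Longrightarrow> evaluate \<sigma> f \<in> M11"
  by (induction f rule: free_alg_var_induct)
    (simp_all add: evaluate_one evaluate_mult[of _ "var _"] evaluate_var evaluate_scalar_mult
      evaluate_add M11_one M11_mult M11_mscale M11_add)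

text \<open>Both sides are linear and turn left multiplication by a variable into the same matrix
  product. Together with \<open>evaluate_M11\<close> this makes the identities closed under
  endomorphisms.\<close>

lemma evaluate_algebra_endo:
  assumes "algebra_endo \<phi>"
  shows "evaluate \<sigma> (\<phi> f) = evaluate (\<lambda>v. evaluate \<sigma> (\<phi> (var v))) f"
proof -
  have \<phi>: "\<phi> 1 = 1" "\<phi> (f + g) = \<phi> f + \<phi> g" "\<phi> (scalar k * f) = scalar k * \<phi> f"
    "\<phi> (var v * f) = \<phi> (var v) * \<phi> f" for f g k v
    using assms unfolding algebra_endo_def by blast+
  show ?thesis
    by (induction f rule: free_alg_var_induct)
      (simp_all add: \<phi> evaluate_one evaluate_mult[of _ "var _"] evaluate_mult[of _ "\<phi> (var _)"]
        evaluate_var evaluate_scalar_mult evaluate_add)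
qed

lemma T_ideal_identities: "T_ideal {f :: ('v, 'k::comm_ring_1) free_alg. identity_of M11 f}"
proof -
  have "identity_of M11 (\<phi> f)" if "algebra_endo \<phi>" "identity_of M11 f"
    for \<phi> and f :: "('v, 'k) free_alg"
    unfolding identity_of_def using that(2)
    by (subst evaluate_algebra_endo[OF that(1)]) (simp add: identity_of_def evaluate_M11)
  then show ?thesis
    unfolding T_ideal_def two_sided_ideal_def
    by (auto simp: identity_of_def evaluate_add evaluate_mult)
qed

text \<open>The identities form a T-ideal, so the two generators suffice.\<close>

lemma hd_ideal_identity:
  fixes f :: "(xy, 'k::field_char_0) free_alg"
  assumes "f \<in> hd_ideal"
  shows "identity_of M11 f"
proof -
  have "identity_of M11 (commutator ((commutator x_var y_var) ^ 2) (x_var :: (xy, 'k) free_alg))"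
    "identity_of M11 ((commutator x_var y_var) ^ 3 :: (xy, 'k) free_alg)"
    unfolding identity_of_def
    by (auto simp: evaluate_commutator evaluate_mult evaluate_var power2_eq_square power3_eq_cube
        mult.assoc M11_commutator_identities)
  then have "hd_ideal \<subseteq> {f :: (xy, 'k) free_alg. identity_of M11 f}"
    unfolding hd_ideal_def T_ideal_generated_def by (intro Inter_lower) (simp add: T_ideal_identities)
  then show ?thesis using assms by auto
qed

section \<open>Independence of the standard elements\<close>

text \<open>The values at the evaluation point form a subalgebra of dimension 6 with explicit multiplication.\<close>

definition model :: "'k \<Rightarrow> 'k \<Rightarrow> 'k \<Rightarrow> 'k \<Rightarrow> 'k \<Rightarrow> 'k \<Rightarrow> 'k::comm_ring_1 gmat" where
  "model a m k l d n = vector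
     [vector [gscale a 1 + gscale m (gbasis {0, 1}), gscale k (ggen 0)],
      vector [gscale l (ggen 1), gscale d 1 + gscale n (gbasis {0, 1})]]"

lemmas gscale_simps =
  module.scale_left_distrib[OF module_gscale] module.scale_right_distrib[OF module_gscale]
  module.scale_left_diff_distrib[OF module_gscale]
  module.scale_scale[OF module_gscale] module.scale_zero_right[OF module_gscale]
  module.scale_zero_left[OF module_gscale] module.scale_minus_left[OF module_gscale]
  module.scale_minus_right[OF module_gscale] module.scale_one[OF module_gscale]

lemma ggen_mult:
  "ggen 0 * ggen 1 = (gbasis {0, 1} :: 'k::comm_ring_1 grassmann)"
  "ggen 1 * ggen 0 = - (gbasis {0, 1} :: 'k grassmann)"
  "ggen 0 * gbasis {0, 1} = 0" "gbasis {0, 1} * ggen 0 = 0" "ggen 1 * gbasis {0, 1} = 0"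
  "gbasis {0, 1} * ggen 1 = 0" "gbasis {0, 1} * gbasis {0, 1} = 0"
proof -
  show *: "ggen 0 * ggen 1 = (gbasis {0, 1} :: 'k grassmann)"
    by (rule gbasis_insert_less[symmetric]) auto
  show "ggen 1 * ggen 0 = - (gbasis {0, 1} :: 'k grassmann)" by (subst ggen_anticommute) (simp only: *)
qed (simp_all add: gbasis_mult)

text \<open>The minus sign in the last entry comes from \<open>e_1 e_0 = - e_0 e_1\<close>.\<close>

lemma model_mult:
  "model a m k l d n ** model a' m' k' l' d' n' =
   model (a * a') (a * m' + m * a' + k * l') (a * k' + k * d') (l * a' + d * l')
     (d * d') (d * n' + n * d' - l * k')"
  by (rule mat2_eqI)
    (simp_all add: mat2_mult model_def distrib_left distrib_right gscale_mult ggen_mult[unfolded One_nat_def]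
      gscale_simps ggen_square add_ac mult.commute)

lemma model_diff:
  "model a m k l d n - model a' m' k' l' d' n' =
   model (a - a') (m - m') (k - k') (l - l') (d - d') (n - n')"
  by (rule mat2_eqI) (simp_all add: model_def gscale_simps)

lemma model_one: "model 1 0 0 0 1 0 = mat 1"
  by (rule mat2_eqI) (simp_all add: model_def gscale_simps mat_def)

lemma model_M11: "model a m k l d n \<in> M11"
  by (simp add: M11_def model_def grass_even_iff grass_odd_iff gscale.rep_eq gbasis.rep_eq
      plus_grassmann.rep_eq one_grassmann.rep_eq)

lemma model_coeffs:
  "gcoeff (model a m k l d n $ 1 $ 1) {} = a" "gcoeff (model a m k l d n $ 1 $ 1) {0, 1} = m"
  "gcoeff (model a m k l d n $ 1 $ 2) {0} = k"
  by (simp_all add: model_def gscale.rep_eq gbasis.rep_eq plus_grassmann.rep_eq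
      one_grassmann.rep_eq)

section \<open>Values of the standard elements\<close>

definition model_eval :: "'k \<Rightarrow> 'k \<Rightarrow> 'k \<Rightarrow> 'k \<Rightarrow> xy \<Rightarrow> 'k::comm_ring_1 gmat" where
  "model_eval s t u v = case_xy (model s 0 0 0 u 0) (model t 0 1 1 v 0)"

lemma model_eval_var:
  "model_eval s t u v Lx = model s 0 0 0 u 0" "model_eval s t u v Ly = model t 0 1 1 v 0"
  by (simp_all add: model_eval_def)

lemma evaluate_x_power: "evaluate (model_eval s t u v) (x_var ^ a) = model (s ^ a) 0 0 0 (u ^ a) 0"
  by (induction a) (simp_all add: evaluate_one model_one evaluate_mult evaluate_var model_eval_var model_mult)

text \<open>The other four coordinates stay anonymous, since the coefficients compared later involve
  only the scalar diagonal parts of the monomials.\<close>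

lemma evaluate_y_power: "\<exists>m k l n. evaluate (model_eval s t u v) (y_var ^ b) = model (t ^ b) m k l (v ^ b) n"
proof (induction b)
  case 0
  show ?case by (metis evaluate_one model_one power_0)
next
  case (Suc b)
  then obtain m k l n where "evaluate (model_eval s t u v) (y_var ^ b) = model (t ^ b) m k l (v ^ b) n"
    by blast
  then show ?case
    by (simp add: evaluate_mult evaluate_var model_eval_var model_mult) blast
qed

lemma evaluate_xy_power:
  "\<exists>m k l n. evaluate (model_eval s t u v) (x_var ^ a * y_var ^ b)
     = model (s ^ a * t ^ b) m k l (u ^ a * v ^ b) n"
proof -
  obtain m k l n where "evaluate (model_eval s t u v) (y_var ^ b) = model (t ^ b) m k l (v ^ b) n"
    using evaluate_y_power by blast
  then show ?thesis
    by (simp add: evaluate_mult evaluate_x_power model_mult) blast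
qed

lemma evaluate_xy_commutator:
  "evaluate (model_eval s t u v) (commutator x_var y_var) = model 0 0 (s - u) (u - s) 0 0"
  by (simp add: evaluate_commutator evaluate_var model_eval_var model_mult model_diff mult.commute)

fun std_class :: "std_index \<Rightarrow> nat" where
  "std_class (Std0 a b) = 0"
| "std_class (Std1 a b i j) = 1"
| "std_class (Std2 a b i j) = 2"

text \<open>The zeros for \<open>Std0\<close> let all three classes share one
  \<open>monomial\<close> function.\<close>

fun std_exponents :: "std_index \<Rightarrow> nat \<times> nat \<times> nat \<times> nat" where
  "std_exponents (Std0 a b) = (a, b, 0, 0)"
| "std_exponents (Std1 a b i j) = (a, b, i, j)"
| "std_exponents (Std2 a b i j) = (a, b, i, j)"

fun monomial :: "'k::comm_ring_1 \<Rightarrow> 'k \<Rightarrow> 'k \<Rightarrow> 'k \<Rightarrow> nat \<times> nat \<times> nat \<times> nat \<Rightarrow> 'k" where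
  "monomial s t u v (a, b, i, j) = s ^ a * t ^ b * u ^ i * v ^ j"

text \<open>The value of \<open>c\<close> is off-diagonal, so it switches from the first diagonal
  entry to the second: the monomial before the first \<open>c\<close> is read at \<open>s\<close>,
  \<open>t\<close> and the one after it at \<open>u\<close>, \<open>v\<close>. Hence all four
  exponents are visible.\<close>

lemma evaluate_std:
  "std_class i = 0 \<Longrightarrow> \<exists>m k l d n. evaluate (model_eval s t u v) (std i)
     = model (monomial s t u v (std_exponents i)) m k l d n"
  "std_class i = 1 \<Longrightarrow> \<exists>m l n. evaluate (model_eval s t u v) (std i)
     = model 0 m ((s - u) * monomial s t u v (std_exponents i)) l 0 n"
  "std_class i = 2 \<Longrightarrow> \<exists>n. evaluate (model_eval s t u v) (std i)
     = model 0 (- (s - u)\<^sup>2 * monomial s t u v (std_exponents i)) 0 0 0 n"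
proof -
  show "\<exists>m k l d n. evaluate (model_eval s t u v) (std i)
     = model (monomial s t u v (std_exponents i)) m k l d n" if "std_class i = 0"
    using that evaluate_xy_power[of s t u v] by (cases i) (auto, metis)
  show "\<exists>m l n. evaluate (model_eval s t u v) (std i)
     = model 0 m ((s - u) * monomial s t u v (std_exponents i)) l 0 n" if "std_class i = 1"
  proof -
    from that obtain a b i' j where i: "i = Std1 a b i' j" by (cases i) auto
    obtain m k l n where 1: "evaluate (model_eval s t u v) (x_var ^ a * y_var ^ b)
     = model (s ^ a * t ^ b) m k l (u ^ a * v ^ b) n" using evaluate_xy_power by blast
    obtain m' k' l' n' where 2: "evaluate (model_eval s t u v) (x_var ^ i' * y_var ^ j)
     = model (s ^ i' * t ^ j) m' k' l' (u ^ i' * v ^ j) n'" using evaluate_xy_power by blast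
    have "evaluate (model_eval s t u v) (std i) = model (s ^ a * t ^ b) m k l (u ^ a * v ^ b) n
        ** model 0 0 (s - u) (u - s) 0 0 ** model (s ^ i' * t ^ j) m' k' l' (u ^ i' * v ^ j) n'"
      unfolding i std.simps evaluate_mult[of _ "_ * commutator _ _"]
        evaluate_mult[of _ _ "commutator _ _"] 1 2 evaluate_xy_commutator ..
    then show ?thesis by (auto simp: model_mult i mult_ac)
  qed
  show "\<exists>n. evaluate (model_eval s t u v) (std i)
     = model 0 (- (s - u)\<^sup>2 * monomial s t u v (std_exponents i)) 0 0 0 n" if "std_class i = 2"
  proof -
    from that obtain a b i' j where i: "i = Std2 a b i' j" by (cases i) auto
    obtain m k l n where 1: "evaluate (model_eval s t u v) (x_var ^ a * y_var ^ b)
     = model (s ^ a * t ^ b) m k l (u ^ a * v ^ b) n" using evaluate_xy_power by blast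
    obtain m' k' l' n' where 2: "evaluate (model_eval s t u v) (x_var ^ i' * y_var ^ j)
     = model (s ^ i' * t ^ j) m' k' l' (u ^ i' * v ^ j) n'" using evaluate_xy_power by blast
    have "evaluate (model_eval s t u v) (std i) = model (s ^ a * t ^ b) m k l (u ^ a * v ^ b) n
        ** (model 0 0 (s - u) (u - s) 0 0 ** model (s ^ i' * t ^ j) m' k' l' (u ^ i' * v ^ j) n'
            ** model 0 0 (s - u) (u - s) 0 0)"
      unfolding i std.simps evaluate_mult[of _ _ "_ * commutator _ _"]
        evaluate_mult[of _ "commutator _ _"] evaluate_mult[of _ "commutator _ _ * _"]
        1 2 evaluate_xy_commutator ..
    then show ?thesis by (auto simp: model_mult i power2_eq_square algebra_simps)
  qed
qed

section \<open>Separation of monomials and linear independence\<close>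

lemma polynomial_identity:
  fixes g :: "'i \<Rightarrow> 'k::idom"
  assumes "finite I" "infinite A" "\<And>s. s \<in> A \<Longrightarrow> (\<Sum>i\<in>I. g i * s ^ e i) = 0"
  shows "(\<Sum>i | i \<in> I \<and> e i = n. g i) = 0"
proof -
  let ?P = "\<Sum>i\<in>I. monom (g i) (e i)"
  have "A \<subseteq> {s. poly ?P s = 0}" using assms(3) by (auto simp: poly_sum poly_monom)
  then have "?P = 0" using poly_roots_finite assms(2) finite_subset by blast
  then have "coeff ?P n = 0" by simp
  then show ?thesis using assms(1) by (simp add: coeff_sum sum.inter_filter)
qed

text \<open>The variables are eliminated one at a time, each step keeping only the indices that
  share one more exponent with \<open>i\<close>; injectivity of \<open>e\<close> leaves
  \<open>i\<close> alone at the end.\<close>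

lemma polynomial_identity_monomial:
  fixes g :: "'i \<Rightarrow> 'k::field_char_0"
  assumes fin: "finite I" and inj: "inj_on e I" and i: "i \<in> I"
    and zero: "\<And>s t u v. s \<noteq> u \<Longrightarrow> (\<Sum>i\<in>I. g i * monomial s t u v (e i)) = 0"
  shows "g i = 0"
proof -
  obtain e1 e2 e3 e4 where e: "e = (\<lambda>i. (e1 i, e2 i, e3 i, e4 i))"
  proof
    show "e = (\<lambda>i. (fst (e i), fst (snd (e i)), fst (snd (snd (e i))), snd (snd (snd (e i)))))"
      by simp
  qed
  have inf: "infinite (UNIV :: 'k set)" "infinite (- {u} :: 'k set)" for u
    by (simp_all add: infinite_UNIV_char_0 Compl_eq_Diff_UNIV)
  define J1 where "J1 = {j \<in> I. e1 j = e1 i}"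
  define J2 where "J2 = {j \<in> J1. e2 j = e2 i}"
  define J3 where "J3 = {j \<in> J2. e3 j = e3 i}"
  define J4 where "J4 = {j \<in> J3. e4 j = e4 i}"
  note J = J1_def J2_def J3_def J4_def
  have fin': "finite J1" "finite J2" "finite J3" using fin by (simp_all add: J)
  \<comment> \<open>With \<open>s\<close> eliminated first, over the infinite set of values other
    than \<open>u\<close>, the remaining variables are unrestricted.\<close>
  have "(\<Sum>j\<in>J1. g j * t ^ e2 j * u ^ e3 j * v ^ e4 j) = 0" for t u v
    unfolding J1_def
    by (rule polynomial_identity[OF fin inf(2)[of u]]) (use zero[of _ u t v] in \<open>auto simp: e mult_ac\<close>)
  then have "(\<Sum>j\<in>J2. g j * u ^ e3 j * v ^ e4 j) = 0" for u v
    unfolding J2_def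
    by (intro polynomial_identity[OF fin'(1) inf(1)]) (simp add: mult_ac)
  then have "(\<Sum>j\<in>J3. g j * v ^ e4 j) = 0" for v
    unfolding J3_def
    by (intro polynomial_identity[OF fin'(2) inf(1)]) (simp add: mult_ac)
  then have "sum g J4 = 0"
    unfolding J4_def by (intro polynomial_identity[OF fin'(3) inf(1)])
  moreover have "J4 = {i}"
    using i inj by (auto simp: J e inj_on_def)
  ultimately show ?thesis by simp
qed

lemma std_index_eqI: "std_class i = std_class j \<Longrightarrow> std_exponents i = std_exponents j \<Longrightarrow> i = j"
  by (cases i; cases j) auto

lemma gcoeff_evaluate_lin_comb:
  "gcoeff (evaluate \<sigma> (lin_comb b p) $ i $ j) A
    = (\<Sum>k\<in>Poly_Mapping.keys p. Poly_Mapping.lookup p k * gcoeff (evaluate \<sigma> (b k) $ i $ j) A)"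
  by (simp add: lin_comb_def evaluate_sum evaluate_scalar_mult mscale_def gcoeff_sum gscale.rep_eq)

lemma std_independent:
  fixes p :: "std_index \<Rightarrow>\<^sub>0 'k::field_char_0"
  assumes "identity_of M11 (lin_comb std p)"
  shows "p = 0"
proof -
  let ?ev = "\<lambda>s t u v. evaluate (model_eval s t u v)"
  let ?K = "\<lambda>n. {i \<in> Poly_Mapping.keys p. std_class i = n}"
  have ev: "?ev s t u v (lin_comb std p) = 0" for s t u v :: 'k
    using assms by (auto simp: identity_of_def model_eval_def model_M11 split: xy.split)
  have coeff: "(\<Sum>k\<in>Poly_Mapping.keys p. Poly_Mapping.lookup p k
      * gcoeff (?ev s t u v (std k) $ i $ j) A) = 0" for s t u v :: 'k and i j A
    by (simp add: gcoeff_evaluate_lin_comb[symmetric] ev zero_grassmann.rep_eq)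
  have cls: "std_class k = 0 \<or> std_class k = 1 \<or> std_class k = 2" for k by (cases k) auto
  have inj: "inj_on std_exponents (?K n)" for n
    by (rule inj_onI) (auto intro: std_index_eqI)
  \<comment> \<open>A matrix coefficient that sees only class \<open>n\<close>, up to a common
    nonzero factor \<open>c s u\<close>, excludes that class from the support of
    \<open>p\<close>.\<close>
  have empty: "?K n = {}"
    if c: "\<And>s u. s \<noteq> u \<Longrightarrow> c s u \<noteq> 0"
      and *: "\<And>s t u v k. k \<in> Poly_Mapping.keys p \<Longrightarrow> gcoeff (?ev s t u v (std k) $ i $ j) A
        = (if std_class k = n then c s u * monomial s t u v (std_exponents k) else 0)"
    for n i j A and c :: "'k \<Rightarrow> 'k \<Rightarrow> 'k"
  proof -
    have "(\<Sum>k\<in>?K n. Poly_Mapping.lookup p k * monomial s t u v (std_exponents k)) = 0"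
      if "s \<noteq> u" for s t u v :: 'k
    proof -
      have "0 = (\<Sum>k\<in>Poly_Mapping.keys p. Poly_Mapping.lookup p k
          * gcoeff (?ev s t u v (std k) $ i $ j) A)"
        by (rule coeff[symmetric])
      also have "\<dots> = (\<Sum>k\<in>Poly_Mapping.keys p. if std_class k = n
          then c s u * (Poly_Mapping.lookup p k * monomial s t u v (std_exponents k)) else 0)"
        by (rule sum.cong) (simp_all add: * mult_ac)
      also have "\<dots> = c s u * (\<Sum>k\<in>?K n. Poly_Mapping.lookup p k * monomial s t u v (std_exponents k))"
        by (simp add: sum.inter_filter[symmetric] sum_distrib_left)
      finally show ?thesis using c[OF that] by simp
    qed
    from polynomial_identity_monomial[OF _ inj _ this] have "Poly_Mapping.lookup p k = 0"
      if "k \<in> ?K n" for k using that by simp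
    then show ?thesis by (auto simp: in_keys_iff)
  qed
  have 0: "?K 0 = {}"
  proof (rule empty)
    fix s t u v :: 'k and k
    show "gcoeff (?ev s t u v (std k) $ 1 $ 1) {}
        = (if std_class k = 0 then 1 * monomial s t u v (std_exponents k) else 0)"
      using cls[of k] evaluate_std[where s = s and t = t and u = u and v = v and i = k]
      by (auto simp: model_coeffs)
  qed simp
  \<comment> \<open>Class 0 may also contribute to this coefficient, so it has to be excluded
    first.\<close>
  have 1: "?K 1 = {}"
  proof (rule empty)
    fix s t u v :: 'k and k
    assume "k \<in> Poly_Mapping.keys p"
    then show "gcoeff (?ev s t u v (std k) $ 1 $ 2) {0}
        = (if std_class k = 1 then (s - u) * monomial s t u v (std_exponents k) else 0)"
      using 0 cls[of k] evaluate_std[where s = s and t = t and u = u and v = v and i = k]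
      by (auto simp: model_coeffs)
  qed simp
  \<comment> \<open>Classes 0 and 1 have unknown coefficients at \<open>e_0 e_1\<close>; both are
    excluded by now.\<close>
  have 2: "?K 2 = {}"
  proof (rule empty)
    fix s t u v :: 'k and k
    assume "k \<in> Poly_Mapping.keys p"
    then show "gcoeff (?ev s t u v (std k) $ 1 $ 1) {0, 1}
        = (if std_class k = 2 then - (s - u)\<^sup>2 * monomial s t u v (std_exponents k) else 0)"
      using 0 1 cls[of k] evaluate_std[where s = s and t = t and u = u and v = v and i = k]
      by (auto simp: model_coeffs[unfolded One_nat_def])
  qed simp
  have "Poly_Mapping.keys p = {}" using 0 1 2 cls by blast
  then show ?thesis by simp
qed

theorem theorem15:
  shows "{f :: (xy, 'k::field_char_0) free_alg. identity_of M11 f} =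
    T_ideal_generated
      {commutator ((commutator x_var y_var) ^ 2) x_var, (commutator x_var y_var) ^ 3}"
proof -
  have "f \<in> hd_ideal" if f: "identity_of M11 f" for f :: "(xy, 'k) free_alg"
  proof -
    obtain p where p: "f - lin_comb std p \<in> hd_ideal" by (rule hd_ideal_standard_form)
    \<comment> \<open>It differs from the identity \<open>f\<close> by an element of
      \<open>hd_ideal\<close>, which is an identity as well.\<close>
    have "identity_of M11 (lin_comb std p)"
      using f hd_ideal_identity[OF p] by (simp add: identity_of_def evaluate_diff)
    then have "p = 0" by (rule std_independent)
    then show ?thesis using p by simp
  qed
  then show ?thesis using hd_ideal_identity unfolding hd_ideal_def[symmetric] by blast
qed

end
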